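(* Let $n\ge 0$ and let $R_n$ be the free rack on generators $y_1,\dots,y_n$. For an integer $z$ and an element $r$ of a rack, write $r\lhd^{\delta_1}\cdots\lhd^{\delta_z}r$ for the left-bracketed expression in which $r$ is acted on successively by $|z|$ copies of $r$, all with exponent $1$ if $z>0$ and all with exponent $-1$ if $z<0$ (and which is just $r$ if $z=0$). 1. Let $\pi=(\pi_h:\mathrm{cod}(h)\to\mathrm{cod}(h))_{\mathrm{dom}(h)=R_n}$ be a (not necessarily natural) family of rack endomorphisms, indexed by the rack morphisms $h$ with domain $R_n$. Then $\pi\in\mathcal{Z}_{\mathrm{Rack}}(R_n)$ if and only if there are a unique integer $z\in\mathbb{Z}$ and a unique reduced group word $y_{i_1}^{\epsilon_1}\cdots y_{i_m}^{\epsilon_m}$ over $y_1,\dots,y_n$ with the property that for every rack morphism $h:R_n\to R$ and every $r\in R$, $$\pi_h(r)=r\lhd^{\delta_1}\cdots\lhd^{\delta_z}r\lhd^{\epsilon_1}h_{i_1}\lhd^{\epsilon_2}\cdots\lhd^{\epsilon_m}h_{i_m}\in R,$$ where $h_i:=h(y_i)$ for $1\le i\le n$. 2. Let $h:R_n\to R_n$ be a rack endomorphism. Then $h$ is a categorical inner automorphism if and only if there are a unique integer $z\in\mathbb{Z}$ and a unique reduced group word $y_{i_1}^{\epsilon_1}\cdots y_{i_m}^{\epsilon_m}$ over $y_1,\dots,y_n$ such that $h(a)=a\lhd^{\delta_1}\cdots\lhd^{\delta_z}a\lhd^{\epsilon_1}y_{i_1}\lhd^{\epsilon_2}\cdots\lhd^{\epsilon_m}y_{i_m}$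 for all $a\in R_n$. 3. Let $h:R_n\to R_n$ be a rack automorphism. Then $h$ is a categorical inner automorphism if and only if $h$ is an algebraic inner automorphism.
   Context: A rack is a set with two binary operations $\lhd,\lhd^{-1}$ satisfying, for all $x,y,z$: $(x\lhd y)\lhd z=(x\lhd z)\lhd(y\lhd z)$; $(x\lhd^{-1}y)\lhd^{-1}z=(x\lhd^{-1}z)\lhd^{-1}(y\lhd^{-1}z)$; $(x\lhd y)\lhd^{-1}y=x$; $(x\lhd^{-1}y)\lhd y=x$. The empty rack is allowed (so $R_0=\emptyset$). Rack morphisms are maps preserving both operations. We write $\lhd^{1}=\lhd$, and bracketing associates to the left: $a\lhd^{\epsilon_1}b_1\lhd^{\epsilon_2}\cdots\lhd^{\epsilon_m}b_m$ means $(\cdots((a\lhd^{\epsilon_1}b_1)\lhd^{\epsilon_2}b_2)\cdots)\lhd^{\epsilon_m}b_m$ (which is $a$ if $m=0$). For a rack $M$, the (covariant) isotropy group $\mathcal{Z}_{\mathrm{Rack}}(M)$ is the group of natural automorphisms of the projection functor $M/\mathrm{Rack}\to\mathrm{Rack}$ from the slice category under $M$. Its elements are the families $\pi=(\pi_h)_h$ of rack automorphisms $\pi_h:\mathrm{cod}(h)\to\mathrm{cod}(h)$, one for each rack morphism $h$ with domain $M$, such that $h'\circ\pi_h=\pi_{h'\circ h}\circ h'$ for all morphisms $h:M\to M'$ and $h':M'\to M''$. An automorphism $h$ of $M$ is a categorical inner automorphism if $h=\pi_{\mathrm{id}_M}$ for some $\pi\in\mathcal{Z}_{\mathrm{Rack}}(M)$.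 An automorphism $f$ of a rack $R$ is an algebraic inner automorphism iff there are $p,k\ge0$, $r_1,\dots,r_k\in R$ and signs $\delta_1,\dots,\delta_p,\epsilon_1,\dots,\epsilon_k=\pm1$ such that for all $r\in R$, $f(r)=(\cdots((((\cdots((r\lhd^{\delta_1}r)\lhd^{\delta_2}r)\cdots)\lhd^{\delta_p}r)\lhd^{\epsilon_1}r_1)\lhd^{\epsilon_2}r_2)\cdots)\lhd^{\epsilon_k}r_k$. A group word $y_{i_1}^{\epsilon_1}\cdots y_{i_m}^{\epsilon_m}$ ($m\ge0$, $1\le i_j\le n$, $\epsilon_j=\pm1$) is reduced if $y_{i_j}=y_{i_{j+1}}$ implies $\epsilon_j=\epsilon_{j+1}$ for all $1\le j<m$ (the empty word counts as reduced).
   Formalization: In part 2, uniqueness of z and the word is claimed only for n ≥ 2 (it fails for n = 0 and n = 1); for all n the equivalence is with existence. Racks range over those with carrier in an arbitrary infinite set containing R_n, from which the claim for all racks follows. *)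

theory Defs
  imports "HOL-Algebra.Congruence" "HOL-Library.FuncSet"
begin

text \<open>
  Racks are carrier-based structures over a type \<open>'u\<close>, which plays the role of the universe:
  the category of racks is rendered as the category of all racks whose carrier is a
  subset of \<open>'u\<close>, and results are stated polymorphically in \<open>'u\<close>.
  The carrier may be empty.
\<close>

record 'u rack = "'u partial_object" +
  rack_op :: "'u \<Rightarrow> 'u \<Rightarrow> 'u"  (infixl \<open>\<lhd>\<index>\<close> 70)
  rack_inv :: "'u \<Rightarrow> 'u \<Rightarrow> 'u"  (infixl \<open>\<lhd>\<inverse>\<index>\<close> 70)

locale rack =
  fixes M :: "'u rack" (structure)
  assumes op_closed: "\<lbrakk>x \<in> carrier M; y \<in> carrier M\<rbrakk> \<Longrightarrow> x \<lhd> y \<in> carrier M"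
    and inv_closed: "\<lbrakk>x \<in> carrier M; y \<in> carrier M\<rbrakk> \<Longrightarrow> x \<lhd>\<inverse> y \<in> carrier M"
    and op_self_distrib: "\<lbrakk>x \<in> carrier M; y \<in> carrier M; z \<in> carrier M\<rbrakk>
      \<Longrightarrow> (x \<lhd> y) \<lhd> z = (x \<lhd> z) \<lhd> (y \<lhd> z)"
    and inv_self_distrib: "\<lbrakk>x \<in> carrier M; y \<in> carrier M; z \<in> carrier M\<rbrakk>
      \<Longrightarrow> (x \<lhd>\<inverse> y) \<lhd>\<inverse> z = (x \<lhd>\<inverse> z) \<lhd>\<inverse> (y \<lhd>\<inverse> z)"
    and inv_op_cancel: "\<lbrakk>x \<in> carrier M; y \<in> carrier M\<rbrakk> \<Longrightarrow> (x \<lhd> y) \<lhd>\<inverse> y = x"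
    and op_inv_cancel: "\<lbrakk>x \<in> carrier M; y \<in> carrier M\<rbrakk> \<Longrightarrow> (x \<lhd>\<inverse> y) \<lhd> y = x"

text \<open>
  Morphisms are extensional functions (value \<open>undefined\<close> off the carrier), so that equality in HOL
  is equality of maps on the carrier.
\<close>

definition rack_hom :: "'u rack \<Rightarrow> 'u rack \<Rightarrow> ('u \<Rightarrow> 'u) set" where
  "rack_hom M N = {f \<in> carrier M \<rightarrow>\<^sub>E carrier N.
     \<forall>x\<in>carrier M. \<forall>y\<in>carrier M.
       f (x \<lhd>\<^bsub>M\<^esub> y) = f x \<lhd>\<^bsub>N\<^esub> f y \<and> f (x \<lhd>\<inverse>\<^bsub>M\<^esub> y) = f x \<lhd>\<inverse>\<^bsub>N\<^esub> f y}"

definition rack_aut :: "'u rack \<Rightarrow> ('u \<Rightarrow> 'u) set" where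
  "rack_aut M = {f \<in> rack_hom M M. bij_betw f (carrier M) (carrier M)}"

text \<open>
  The free rack on \<open>n\<close> generators \<open>y 1, \<dots>, y n\<close>, given by its universal property among the
  racks in the universe \<open>'u\<close>. When \<open>'u\<close> is infinite this agrees with freeness among all racks,
  because finitely generated racks are countable and hence have a copy inside \<open>'u\<close>.
\<close>

definition free_rack :: "'u rack \<Rightarrow> nat \<Rightarrow> (nat \<Rightarrow> 'u) \<Rightarrow> bool" where
  "free_rack R n y \<longleftrightarrow> rack R \<and> y \<in> {1..n} \<rightarrow> carrier R \<and>
     (\<forall>N. rack N \<longrightarrow> (\<forall>g \<in> {1..n} \<rightarrow> carrier N.
        \<exists>!f. f \<in> rack_hom R N \<and> (\<forall>i\<in>{1..n}. f (y i) = g i)))"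

text \<open>
  A sign is a boolean, with \<open>True\<close> for \<open>1\<close> and \<open>False\<close> for \<open>-1\<close>; \<open>acts M a [(b\<^sub>1, \<epsilon>\<^sub>1), \<dots>, (b\<^sub>m, \<epsilon>\<^sub>m)]\<close>
  is the left-bracketed expression in which \<open>a\<close> is acted on by \<open>b\<^sub>1\<close>, then \<open>b\<^sub>2\<close>, and so on.
\<close>

definition act :: "'u rack \<Rightarrow> 'u \<Rightarrow> 'u \<times> bool \<Rightarrow> 'u" where
  "act M a = (\<lambda>(b, s). if s then a \<lhd>\<^bsub>M\<^esub> b else a \<lhd>\<inverse>\<^bsub>M\<^esub> b)"

definition acts :: "'u rack \<Rightarrow> 'u \<Rightarrow> ('u \<times> bool) list \<Rightarrow> 'u" where
  "acts M a bs = foldl (act M) a bs"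

definition self_acts :: "'u rack \<Rightarrow> 'u \<Rightarrow> int \<Rightarrow> 'u" where
  "self_acts M r z = acts M r (replicate (nat \<bar>z\<bar>) (r, z > 0))"

text \<open>A letter \<open>(i, s)\<close> of a group word stands for the generator \<open>y\<^sub>i\<close> with exponent given by the sign \<open>s\<close>.\<close>

definition reduced_words :: "nat \<Rightarrow> (nat \<times> bool) list set" where
  "reduced_words n = {w. fst ` set w \<subseteq> {1..n} \<and>
     (\<forall>j. Suc j < length w \<longrightarrow> fst (w ! j) = fst (w ! Suc j) \<longrightarrow> snd (w ! j) = snd (w ! Suc j))}"

definition word_acts :: "'u rack \<Rightarrow> (nat \<Rightarrow> 'u) \<Rightarrow> 'u \<Rightarrow> (nat \<times> bool) list \<Rightarrow> 'u" where
  "word_acts M g a w = acts M a (map (\<lambda>(i, s). (g i, s)) w)"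

text \<open>
  A family indexed by the rack morphisms out of a fixed rack: \<open>\<pi> N h\<close> is the component at
  \<open>h\<close>, regarded as a morphism with codomain \<open>N\<close>. Only indices with \<open>rack N\<close> and
  \<open>h \<in> rack_hom M N\<close> are meaningful; all other values of \<open>\<pi>\<close> are irrelevant.
\<close>

type_synonym 'u rack_family = "'u rack \<Rightarrow> ('u \<Rightarrow> 'u) \<Rightarrow> ('u \<Rightarrow> 'u)"

definition endo_family :: "'u rack \<Rightarrow> 'u rack_family \<Rightarrow> bool" where
  "endo_family M \<pi> \<longleftrightarrow> (\<forall>N h. rack N \<longrightarrow> h \<in> rack_hom M N \<longrightarrow> \<pi> N h \<in> rack_hom N N)"

definition isotropy :: "'u rack \<Rightarrow> 'u rack_family set" where
  "isotropy M = {\<pi>.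
     (\<forall>N h. rack N \<longrightarrow> h \<in> rack_hom M N \<longrightarrow> \<pi> N h \<in> rack_aut N) \<and>
     (\<forall>N N' h h'. rack N \<longrightarrow> rack N' \<longrightarrow> h \<in> rack_hom M N \<longrightarrow> h' \<in> rack_hom N N' \<longrightarrow>
        compose (carrier N) h' (\<pi> N h) =
        compose (carrier N) (\<pi> N' (compose (carrier M) h' h)) h')}"

definition categorical_inner :: "'u rack \<Rightarrow> ('u \<Rightarrow> 'u) \<Rightarrow> bool" where
  "categorical_inner M f \<longleftrightarrow> f \<in> rack_aut M \<and>
     (\<exists>\<pi> \<in> isotropy M. f = \<pi> M (restrict id (carrier M)))"

definition algebraic_inner :: "'u rack \<Rightarrow> ('u \<Rightarrow> 'u) \<Rightarrow> bool" where
  "algebraic_inner M f \<longleftrightarrow> f \<in> rack_aut M \<and>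
     (\<exists>\<delta>s rs. fst ` set rs \<subseteq> carrier M \<and>
        (\<forall>r\<in>carrier M. f r = acts M r (map (\<lambda>\<delta>. (r, \<delta>)) \<delta>s @ rs)))"

end

theory Submission
  imports Defs "HOL-Library.Countable"
begin

text \<open>
  Adjoin a generator \<open>x\<close> to the free rack. By naturality an element \<open>\<pi>\<close> of the isotropy group is
  determined by its value at \<open>x\<close>, which is some generator acted on by a group word \<open>g\<close>. This
  generator is \<open>x\<close> itself, as \<open>\<pi>\<close> would otherwise be constant on racks with trivial operations.
  Applying \<open>\<pi> (r \<lhd> x) = \<pi> r \<lhd> \<pi> x\<close> to an element \<open>r\<close> that acts trivially yields
  \<open>x w = w g\<inverse> x g\<close>, where \<open>w\<close> arises from \<open>g\<close> by deleting the letter \<open>x\<close>. So \<open>g w\<inverse>\<close>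
  centralizes \<open>x\<close> in a free group and is a power \<open>x\<^sup>z\<close>, whence \<open>g = x\<^sup>z w\<close>. Here \<open>z\<close> is the
  exponent sum of \<open>x\<close>, which together with left cancellation gives uniqueness.
\<close>

section \<open>Reduced words\<close>

type_synonym 'a word = "('a \<times> bool) list"

definition flip :: "'a \<times> bool \<Rightarrow> 'a \<times> bool" where
  "flip l = (fst l, \<not> snd l)"

definition winv :: "'a word \<Rightarrow> 'a word" where
  "winv w = rev (map flip w)"

definition reduced :: "'a word \<Rightarrow> bool" where
  "reduced = successively (\<lambda>a b. b \<noteq> flip a)"

text \<open>Right multiplication by a letter on normal forms of the free group; \<open>mul\<close>
  iterates it, so that \<open>mul [] p\<close> is the normal form of \<open>p\<close>.\<close>

definition mul_letter :: "'a word \<Rightarrow> 'a \<times> bool \<Rightarrow> 'a word" where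
  "mul_letter w l = (if w \<noteq> [] \<and> last w = flip l then butlast w else w @ [l])"

definition mul :: "'a word \<Rightarrow> 'a word \<Rightarrow> 'a word" where
  "mul = foldl mul_letter"

text \<open>Equality in the free group, encoded as in Cayley's representation: two words are
  identified when they act alike by right multiplication on normal forms. The congruence laws then
  come from unfolding, and no quotient is formed.\<close>

definition weq :: "'a word \<Rightarrow> 'a word \<Rightarrow> bool"  (infix "\<approx>" 50) where
  "p \<approx> q \<longleftrightarrow> (\<forall>u. reduced u \<longrightarrow> mul u p = mul u q)"

text \<open>The homomorphism from the free group to the integers that sends the letter
  \<open>c\<close> to 1 and every other letter to 0.\<close>

definition expsum :: "'a \<Rightarrow> 'a word \<Rightarrow> int" where
  "expsum c w = (\<Sum>(i, s)\<leftarrow>w. if i = c then if s then 1 else -1 else 0)"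

lemma flip_flip [simp]: "flip (flip l) = l"
  and fst_flip [simp]: "fst (flip l) = fst l"
  and flip_Pair [simp]: "flip (i, s) = (i, \<not> s)"
  by (cases l; simp add: flip_def)+

lemma winv_simps [simp]:
  "winv [] = []" "winv (l # w) = winv w @ [flip l]" "winv (p @ q) = winv q @ winv p"
  by (simp_all add: winv_def)

lemma winv_winv [simp]: "winv (winv w) = w"
  by (induction w) simp_all

lemma set_winv [simp]: "fst ` set (winv w) = fst ` set w"
  by (simp add: winv_def image_image)

lemma reduced_Nil [simp]: "reduced []"
  and reduced_Cons: "reduced (l # w) \<longleftrightarrow> reduced w \<and> (w = [] \<or> hd w \<noteq> flip l)"
  and reduced_snoc: "reduced (w @ [l]) \<longleftrightarrow> reduced w \<and> (w = [] \<or> last w \<noteq> flip l)"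
  by (auto simp: reduced_def successively_Cons successively_append_iff)

lemma reduced_words_iff: "w \<in> reduced_words n \<longleftrightarrow> fst ` set w \<subseteq> {1..n} \<and> reduced w"
proof -
  have "b \<noteq> flip a \<longleftrightarrow> (fst a = fst b \<longrightarrow> snd a = snd b)" for a b :: "nat \<times> bool"
    by (auto simp: flip_def prod_eq_iff)
  then show ?thesis
    by (simp add: reduced_words_def reduced_def successively_conv_nth)
qed

lemma reduced_butlast: "reduced w \<Longrightarrow> reduced (butlast w)"
  by (cases w rule: rev_cases) (simp_all add: reduced_snoc)

lemma reduced_mul_letter: "reduced w \<Longrightarrow> reduced (mul_letter w l)"
  by (auto simp: mul_letter_def reduced_snoc reduced_butlast)

text \<open>If \<open>l\<close> cancels the last letter of \<open>w\<close>, then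
  \<open>flip l\<close> must be appended again rather than cancelled; reducedness ensures that the
  letter before it is not \<open>l\<close>. This makes letters act invertibly on normal
  forms.\<close>

lemma mul_letter_flip:
  assumes "reduced w" shows "mul_letter (mul_letter w l) (flip l) = w"
proof (cases "w \<noteq> [] \<and> last w = flip l")
  case True
  then have w: "w = butlast w @ [flip l]" by (metis append_butlast_last_id)
  with assms have "butlast w = [] \<or> last (butlast w) \<noteq> l" by (metis reduced_snoc flip_flip)
  then show ?thesis using True w by (auto simp: mul_letter_def)
qed (auto simp: mul_letter_def)

lemma mul_simps [simp]:
  "mul u [] = u" "mul u (l # p) = mul (mul_letter u l) p" "mul u (p @ q) = mul (mul u p) q"
  by (simp_all add: mul_def)

lemma reduced_mul [simp]: "reduced u \<Longrightarrow> reduced (mul u p)"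
  by (induction p arbitrary: u) (simp_all add: reduced_mul_letter)

lemma mul_append_reduced: "reduced (u @ p) \<Longrightarrow> mul u p = u @ p"
proof (induction p rule: rev_induct)
  case (snoc l p)
  from snoc.prems have "reduced (u @ p)" "u @ p = [] \<or> last (u @ p) \<noteq> flip l"
    using reduced_snoc[of "u @ p" l] by auto
  then show ?case
    using snoc.IH by (auto simp: mul_letter_def)
qed simp

lemma mul_Nil_reduced: "reduced p \<Longrightarrow> mul [] p = p"
  using mul_append_reduced[of "[]" p] by simp

lemma set_mul: "set (mul u p) \<subseteq> set u \<union> set p"
proof (induction p arbitrary: u)
  case (Cons l p)
  have "set (mul_letter u l) \<subseteq> insert l (set u)"
    by (auto simp: mul_letter_def dest: in_set_butlastD)
  with Cons[of "mul_letter u l"] show ?case by auto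
qed simp

lemma letters_mul: "fst ` set (mul u p) \<subseteq> fst ` set u \<union> fst ` set p"
  using set_mul[of u p] by blast

section \<open>Equality of words in the free group\<close>

lemma weq_refl [simp]: "p \<approx> p"
  and weq_sym: "p \<approx> q \<Longrightarrow> q \<approx> p"
  and weq_trans [trans]: "p \<approx> q \<Longrightarrow> q \<approx> r \<Longrightarrow> p \<approx> r"
  and weq_append: "p \<approx> q \<Longrightarrow> p' \<approx> q' \<Longrightarrow> p @ p' \<approx> q @ q'"
  by (simp_all add: weq_def)

lemma weq_flip: "[l, flip l] \<approx> []"
  by (simp add: weq_def mul_letter_flip)

lemma weq_winv_right: "p @ winv p \<approx> []"
proof (induction p)
  case (Cons l p)
  have "[l] @ (p @ winv p) @ [flip l] \<approx> [l] @ [] @ [flip l]"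
    by (intro weq_append weq_refl Cons)
  also have "[l] @ [] @ [flip l] \<approx> []"
    by (simp add: weq_flip)
  finally show ?case by simp
qed simp

lemma weq_winv_left: "winv p @ p \<approx> []"
  using weq_winv_right[of "winv p"] by simp

lemma weq_winv: assumes "p \<approx> q" shows "winv p \<approx> winv q"
proof -
  have "winv p @ [] \<approx> winv p @ (q @ winv q)"
    by (intro weq_append weq_refl weq_sym[OF weq_winv_right])
  also have "winv p @ (q @ winv q) \<approx> (winv p @ p) @ winv q"
    using weq_append[OF weq_refl weq_append[OF weq_sym[OF assms] weq_refl]] by simp
  also have "(winv p @ p) @ winv q \<approx> [] @ winv q"
    by (intro weq_append weq_refl weq_winv_left)
  finally show ?thesis by simp
qed

lemma weq_mul_letter: "mul_letter w l \<approx> w @ [l]"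
proof (cases w rule: rev_cases)
  case (snoc v k)
  show ?thesis
  proof (cases "k = flip l")
    case True
    have "v @ [] \<approx> v @ [k, l]"
      using weq_append[OF weq_refl weq_sym[OF weq_flip[of k]]] by (simp add: True)
    then show ?thesis by (simp add: mul_letter_def snoc True)
  qed (simp add: mul_letter_def snoc)
qed (simp add: mul_letter_def)

lemma weq_mul: "mul w p \<approx> w @ p"
proof (induction p arbitrary: w)
  case (Cons l p)
  have "mul (mul_letter w l) p \<approx> mul_letter w l @ p"
    by (rule Cons)
  also have "mul_letter w l @ p \<approx> (w @ [l]) @ p"
    by (intro weq_append weq_mul_letter weq_refl)
  finally show ?case by simp
qed simp

lemma weq_reduce: "mul [] p \<approx> p"
  using weq_mul[of "[]" p] by simp

text \<open>Uniqueness of normal forms: let both words act on the empty word, which returns a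
  reduced word unchanged.\<close>

lemma weq_reduced_eq: "p \<approx> q \<Longrightarrow> reduced p \<Longrightarrow> reduced q \<Longrightarrow> p = q"
  by (metis mul_Nil_reduced reduced_Nil weq_def)

lemma weq_iff: "p \<approx> q \<longleftrightarrow> mul [] p = mul [] q"
proof
  assume *: "mul [] p = mul [] q"
  have "p \<approx> mul [] p" by (rule weq_sym[OF weq_reduce])
  also have "mul [] p \<approx> q" unfolding * by (rule weq_reduce)
  finally show "p \<approx> q" .
qed (simp add: weq_def)

lemma weq_cancel_left: assumes "p @ q \<approx> p @ r" shows "q \<approx> r"
proof -
  have "[] @ q \<approx> (winv p @ p) @ q"
    by (intro weq_append weq_refl weq_sym[OF weq_winv_left])
  also have "(winv p @ p) @ q \<approx> (winv p @ p) @ r"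
    using weq_append[OF weq_refl assms] by simp
  also have "(winv p @ p) @ r \<approx> [] @ r"
    by (intro weq_append weq_refl weq_winv_left)
  finally show ?thesis by simp
qed

section \<open>Exponent sums and the centralizer of a letter\<close>

lemma expsum_simps [simp]:
  "expsum c [] = 0"
  "expsum c ((i, s) # w) = (if i = c then if s then 1 else -1 else 0) + expsum c w"
  "expsum c (p @ q) = expsum c p + expsum c q"
  by (simp_all add: expsum_def)

lemma expsum_flip: "expsum c [flip l] = - expsum c [l]"
  by (cases l) simp

lemma expsum_mul_letter: "expsum c (mul_letter w l) = expsum c w + expsum c [l]"
  by (cases w rule: rev_cases) (auto simp: mul_letter_def expsum_flip)

lemma expsum_mul [simp]: "expsum c (mul u p) = expsum c u + expsum c p"
proof (induction p arbitrary: u)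
  case (Cons l p)
  then show ?case by (cases l) (simp add: expsum_mul_letter)
qed simp

lemma expsum_weq: "p \<approx> q \<Longrightarrow> expsum c p = expsum c q"
  by (metis add_0 expsum_mul expsum_simps(1) weq_iff)

lemma expsum_eq_0: "c \<notin> fst ` set w \<Longrightarrow> expsum c w = 0"
  by (induction w) force+

lemma expsum_replicate: "expsum c (replicate k (c, s)) = (if s then int k else - int k)"
  by (induction k) simp_all

text \<open>A first letter that is \<open>c\<close> or its inverse commutes with \<open>c\<close>
  and can be cancelled on the left. With any other first letter, \<open>(c, True) # u\<close> is
  already reduced, so by length nothing cancels in \<open>u @ [(c, True)]\<close> either; the two
  lists are then equal, although their first letters differ.\<close>

lemma centralizer_letter:
  assumes "reduced u" "(c, True) # u \<approx> u @ [(c, True)]"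
  shows "fst ` set u \<subseteq> {c}"
  using assms
proof (induction u)
  case (Cons l u)
  let ?x = "(c, True)"
  show ?case
  proof (cases "fst l = c")
    case True
    have "[l] @ (?x # u) \<approx> [l] @ (u @ [?x])"
    proof -
      have "[l, ?x] \<approx> [?x, l]"
      proof (cases "snd l")
        case False
        with True have l: "l = flip ?x" by (simp add: prod_eq_iff)
        have "[l, ?x] \<approx> []" using weq_flip[of l] l by simp
        also have "[] \<approx> [?x, l]" using weq_sym[OF weq_flip[of ?x]] l by simp
        finally show ?thesis .
      qed (use True in \<open>simp add: prod_eq_iff weq_def; cases l; simp\<close>)
      then have "[l, ?x] @ u \<approx> [?x, l] @ u" by (intro weq_append weq_refl)
      also have "[?x, l] @ u \<approx> (l # u) @ [?x]" using Cons.prems by simp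
      finally show ?thesis by simp
    qed
    then have "?x # u \<approx> u @ [?x]" by (rule weq_cancel_left)
    with Cons True show ?thesis by (simp add: reduced_Cons)
  next
    case False
    then have r: "reduced (?x # l # u)"
      using Cons.prems(1) by (auto simp: reduced_Cons[of ?x])
    have "?x # l # u \<approx> mul_letter (l # u) ?x"
      using Cons.prems(2) weq_sym[OF weq_mul_letter[of "l # u" ?x]] weq_trans by blast
    then have "?x # l # u = mul_letter (l # u) ?x"
      using r Cons.prems(1) by (intro weq_reduced_eq reduced_mul_letter)
    then have "?x # l # u = (l # u) @ [?x]"
      by (auto simp: mul_letter_def split: if_splits dest: arg_cong[where f = length])
    with False show ?thesis by auto
  qed
qed simp

section \<open>Actions in a rack\<close>

context rack
begin

lemma act_closed [simp]: "a \<in> carrier M \<Longrightarrow> fst b \<in> carrier M \<Longrightarrow> act M a b \<in> carrier M"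
  by (cases b) (simp add: act_def op_closed inv_closed)

lemma act_flip: "a \<in> carrier M \<Longrightarrow> fst b \<in> carrier M \<Longrightarrow> act M (act M a b) (flip b) = a"
  by (cases b) (simp add: act_def inv_op_cancel op_inv_cancel)

lemma act_distrib_same:
  "\<lbrakk>a \<in> carrier M; b \<in> carrier M; c \<in> carrier M\<rbrakk> \<Longrightarrow>
    act M (act M a (b, s)) (c, s) = act M (act M a (c, s)) (act M b (c, s), s)"
  by (simp add: act_def op_self_distrib inv_self_distrib)

text \<open>The axioms cover equal signs only. For opposite signs, act on the left side by the image
  of \<open>b\<close> with sign \<open>s\<close>: equal-sign distributivity and cancellation turn
  the result into \<open>act M a (c, s)\<close>, and that action is invertible.\<close>

lemma act_distrib:
  assumes "a \<in> carrier M" "b \<in> carrier M" "c \<in> carrier M"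
  shows "act M (act M a (b, t)) (c, s) = act M (act M a (c, s)) (act M b (c, s), t)"
proof (cases "t = s")
  case False
  have "act M (act M (act M a (b, t)) (c, s)) (act M b (c, s), s) = act M (act M (act M a (b, t)) (b, s)) (c, s)"
    using act_distrib_same[of "act M a (b, t)" b c s] assms by simp
  also have "\<dots> = act M a (c, s)"
    using assms False act_flip[of a "(b, t)"] by simp
  finally show ?thesis
    using assms False act_flip[of "act M (act M a (b, t)) (c, s)" "(act M b (c, s), s)"] by simp
qed (use assms act_distrib_same in blast)

lemma acts_closed [simp]: "a \<in> carrier M \<Longrightarrow> fst ` set bs \<subseteq> carrier M \<Longrightarrow> acts M a bs \<in> carrier M"
  by (induction bs arbitrary: a) (simp_all add: acts_def)

end

lemma acts_simps [simp]:
  "acts M a [] = a" "acts M a (b # bs) = acts M (act M a b) bs"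
  "acts M a (bs @ cs) = acts M (acts M a bs) cs"
  by (simp_all add: acts_def)

lemma word_acts_simps [simp]:
  "word_acts M g a [] = a" "word_acts M g a ((i, s) # w) = word_acts M g (act M a (g i, s)) w"
  "word_acts M g a (v @ w) = word_acts M g (word_acts M g a v) w"
  by (simp_all add: word_acts_def)

text \<open>Both equations include \<open>k = 0\<close>, where the list is empty and its sign does
  not matter.\<close>

lemma self_acts_int:
  "self_acts M r (int k) = acts M r (replicate k (r, True))"
  "self_acts M r (- int k) = acts M r (replicate k (r, False))"
  by (cases k; simp add: self_acts_def nat_add_distrib)+

lemma word_acts_cong: "(\<And>i. i \<in> fst ` set w \<Longrightarrow> g i = g' i) \<Longrightarrow> word_acts M g a w = word_acts M g' a w"
  by (induction w arbitrary: a) auto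

context rack
begin

lemma word_acts_closed [simp]:
  "a \<in> carrier M \<Longrightarrow> g ` fst ` set w \<subseteq> carrier M \<Longrightarrow> word_acts M g a w \<in> carrier M"
  unfolding word_acts_def by (rule acts_closed) (auto simp: image_image split: prod.splits)

lemma self_acts_closed [simp]: "a \<in> carrier M \<Longrightarrow> self_acts M a z \<in> carrier M"
  unfolding self_acts_def by (rule acts_closed) (auto simp: set_replicate_conv_if)

lemma word_acts_mul_letter:
  assumes "a \<in> carrier M" "g ` fst ` set w \<subseteq> carrier M" "g (fst l) \<in> carrier M"
  shows "word_acts M g a (mul_letter w l) = word_acts M g a (w @ [l])"
proof (cases w rule: rev_cases)
  case (snoc v k)
  obtain i s where "l = (i, s)" by (cases l)
  with assms snoc act_flip[of "word_acts M g a v" "(g i, \<not> s)"] show ?thesis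
    by (auto simp: mul_letter_def)
qed (simp add: mul_letter_def)

lemma word_acts_mul:
  assumes "a \<in> carrier M" "g ` fst ` set w \<subseteq> carrier M" "g ` fst ` set p \<subseteq> carrier M"
  shows "word_acts M g a (mul w p) = word_acts M g a (w @ p)"
  using assms
proof (induction p rule: rev_induct)
  case (snoc l p)
  have "g ` fst ` set (mul w p) \<subseteq> g ` (fst ` set w \<union> fst ` set p)"
    by (intro image_mono letters_mul)
  also have "\<dots> \<subseteq> carrier M"
    using snoc.prems by (simp add: image_Un)
  finally have "g ` fst ` set (mul w p) \<subseteq> carrier M" .
  moreover have "g (fst l) \<in> carrier M"
    using snoc.prems by simp
  ultimately have "word_acts M g a (mul_letter (mul w p) l) = word_acts M g a (mul w p @ [l])"
    using snoc.prems by (intro word_acts_mul_letter)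
  with snoc show ?case by (simp add: image_Un)
qed simp

text \<open>Each letter acts by a bijection whose inverse is the action of the flipped letter, so
  the action on a carrier element depends only on the free group element and may be computed on
  normal forms.\<close>

lemma word_acts_weq:
  assumes "p \<approx> q" "a \<in> carrier M" "g ` fst ` set p \<subseteq> carrier M" "g ` fst ` set q \<subseteq> carrier M"
  shows "word_acts M g a p = word_acts M g a q"
  using assms word_acts_mul[of a g "[]" p] word_acts_mul[of a g "[]" q] by (simp add: weq_iff)

lemma word_acts_distrib:
  assumes "a \<in> carrier M" "b \<in> carrier M" "g ` fst ` set w \<subseteq> carrier M"
  shows "word_acts M g (act M a (b, t)) w = act M (word_acts M g a w) (word_acts M g b w, t)"
  using assms
proof (induction w arbitrary: a b)
  case (Cons l w)
  then show ?case by (cases l) (simp add: act_distrib[of a b])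
qed simp

lemma word_acts_winv:
  assumes "a \<in> carrier M" "g ` fst ` set w \<subseteq> carrier M"
  shows "word_acts M g (word_acts M g a w) (winv w) = a"
    and "word_acts M g (word_acts M g a (winv w)) w = a"
proof -
  show "word_acts M g (word_acts M g a w) (winv w) = a"
    using assms word_acts_weq[OF weq_winv_right, of a g w] by (simp add: image_Un)
  show "word_acts M g (word_acts M g a (winv w)) w = a"
    using assms word_acts_weq[OF weq_winv_left, of a g w] by (simp add: image_Un)
qed

text \<open>The conjugation rule: the element obtained from \<open>b\<close> by \<open>w\<close>
  acts as \<open>winv w\<close>, then \<open>b\<close>, then \<open>w\<close>. It is
  \<open>word_acts_distrib\<close> applied to \<open>a\<close> moved back along
  \<open>w\<close>.\<close>

lemma act_word_acts:
  assumes "a \<in> carrier M" "b \<in> carrier M" "g ` fst ` set w \<subseteq> carrier M"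
  shows "act M a (word_acts M g b w, t) = word_acts M g (act M (word_acts M g a (winv w)) (b, t)) w"
  using assms word_acts_distrib[of "word_acts M g a (winv w)" b g w t] word_acts_winv(2)[of a g w]
  by simp

text \<open>\<open>self_acts\<close> uses a single sign throughout, so a further self-action either
  lengthens the list or cancels its last entry; a negative step from 0 switches to the list with
  negative sign.\<close>

lemma self_acts_step:
  assumes "r \<in> carrier M"
  shows "act M (self_acts M r z) (r, s) = self_acts M r (z + (if s then 1 else -1))"
proof -
  have snoc: "acts M r (replicate (Suc k) (r, t)) = act M (acts M r (replicate k (r, t))) (r, t)" for k t
    by (metis acts_simps replicate_Suc replicate_append_same)
  have c: "acts M r (replicate k (r, t)) \<in> carrier M" for k t
    using assms by (auto simp: set_replicate_conv_if)
  have cancel: "act M (acts M r (replicate (Suc k) (r, t))) (r, \<not> t) = acts M r (replicate k (r, t))" for k t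
    unfolding snoc using act_flip[OF c, of "(r, t)"] assms by simp
  show ?thesis
  proof (cases z rule: int_cases)
    case (nonneg k)
    show ?thesis
    proof (cases s)
      case True
      then have "z + (if s then 1 else -1) = int (Suc k)" using nonneg by simp
      then show ?thesis using True nonneg by (simp only: self_acts_int snoc)
    next
      case False
      show ?thesis
      proof (cases k)
        case 0
        then have "z + (if s then 1 else -1) = - int (Suc 0)" using False nonneg by simp
        then show ?thesis using False nonneg 0 by (simp only: self_acts_int) simp
      next
        case (Suc j)
        then have "z + (if s then 1 else -1) = int j" using False nonneg by simp
        then show ?thesis using False nonneg Suc cancel[of j True] by (simp only: self_acts_int simp_thms)
      qed
    qed
  next
    case (neg k)
    show ?thesis
    proof (cases s)
      case False
      then have "z + (if s then 1 else -1) = - int (Suc (Suc k))" using neg by simp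
      then show ?thesis using False neg snoc[of "Suc k"] by (simp only: self_acts_int)
    next
      case True
      then have "z + (if s then 1 else -1) = - int k" using neg by simp
      then show ?thesis using True neg cancel[of k False] by (simp only: self_acts_int simp_thms)
    qed
  qed
qed

text \<open>Turns an arbitrary mixture of signs in self-actions into one integer; it is applied with
  a letter \<open>c\<close> that stands for the argument \<open>r\<close>.\<close>

lemma word_acts_self:
  assumes "r \<in> carrier M" "fst ` set w \<subseteq> {c}" "g c = r"
  shows "word_acts M g r w = self_acts M r (expsum c w)"
  using assms(2)
proof (induction w rule: rev_induct)
  case Nil
  then show ?case by (simp add: self_acts_def)
next
  case (snoc l w)
  then obtain s where "l = (c, s)" by (cases l) auto
  with snoc assms self_acts_step[OF assms(1), of "expsum c w" s] show ?case by simp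
qed

end

section \<open>Rack homomorphisms\<close>

lemma rack_homD:
  assumes "f \<in> rack_hom M N"
  shows "x \<in> carrier M \<Longrightarrow> f x \<in> carrier N"
    and "\<lbrakk>x \<in> carrier M; y \<in> carrier M\<rbrakk> \<Longrightarrow> f (act M x (y, t)) = act N (f x) (f y, t)"
    and "f \<in> extensional (carrier M)"
  using assms by (auto simp: rack_hom_def act_def PiE_def)

lemma rack_homI:
  assumes "\<And>x. x \<in> carrier M \<Longrightarrow> f x \<in> carrier N"
    and "\<And>x y t. \<lbrakk>x \<in> carrier M; y \<in> carrier M\<rbrakk> \<Longrightarrow> f (act M x (y, t)) = act N (f x) (f y, t)"
    and "f \<in> extensional (carrier M)"
  shows "f \<in> rack_hom M N"
  using assms(1,3) assms(2)[where t = True] assms(2)[where t = False]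
  by (auto simp: rack_hom_def act_def PiE_def)

lemma rack_hom_compose:
  assumes "rack M" "f \<in> rack_hom M N" "g \<in> rack_hom N P"
  shows "compose (carrier M) g f \<in> rack_hom M P"
proof -
  interpret rack M by fact
  show ?thesis
    by (rule rack_homI)
       (use rack_homD[OF assms(2)] rack_homD[OF assms(3)] in \<open>simp_all add: compose_def\<close>)
qed

lemma rack_hom_id: "rack M \<Longrightarrow> restrict id (carrier M) \<in> rack_hom M M"
  by (rule rack_homI) (simp_all add: rack.act_closed)

lemma rack_hom_acts:
  assumes "rack M" "f \<in> rack_hom M N" "a \<in> carrier M" "fst ` set bs \<subseteq> carrier M"
  shows "f (acts M a bs) = acts N (f a) (map (\<lambda>(b, s). (f b, s)) bs)"
proof -
  interpret rack M by fact
  show ?thesis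
    using assms(3,4)
  proof (induction bs arbitrary: a)
    case (Cons b bs)
    then show ?case by (cases b) (simp add: rack_homD[OF assms(2)])
  qed simp
qed

lemma rack_hom_word_acts:
  assumes "rack M" "f \<in> rack_hom M N" "a \<in> carrier M" "g ` fst ` set w \<subseteq> carrier M"
  shows "f (word_acts M g a w) = word_acts N (\<lambda>i. f (g i)) (f a) w"
proof -
  have "fst ` set (map (\<lambda>(i, s). (g i, s)) w) \<subseteq> carrier M"
    using assms(4) by (auto simp: image_image split: prod.splits)
  from rack_hom_acts[OF assms(1-3) this] show ?thesis
    by (simp add: word_acts_def comp_def case_prod_unfold)
qed

lemma rack_hom_self_acts:
  assumes "rack M" "f \<in> rack_hom M N" "a \<in> carrier M"
  shows "f (self_acts M a z) = self_acts N (f a) z"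
  unfolding self_acts_def by (subst rack_hom_acts[OF assms]) (use assms(3) in \<open>auto simp: set_replicate_conv_if\<close>)

section \<open>Automorphisms given by an integer and a word\<close>

context rack
begin

lemma act_hom: "c \<in> carrier M \<Longrightarrow> (\<lambda>a\<in>carrier M. act M a (c, s)) \<in> rack_hom M M"
  by (rule rack_homI) (simp_all, blast intro: act_distrib)

text \<open>Conjugating the action of \<open>b\<close> by itself changes nothing. Formally, move
  \<open>a\<close> back by \<open>b\<close> with the opposite sign, distribute, and cancel.\<close>

lemma act_act_self:
  assumes "a \<in> carrier M" "b \<in> carrier M"
  shows "act M a (act M b (b, s), t) = act M a (b, t)"
proof -
  have "act M a (act M b (b, s), t) = act M (act M (act M a (b, \<not> s)) (b, t)) (b, s)"
    using act_distrib[of "act M a (b, \<not> s)" b b t s] act_flip[of a "(b, \<not> s)"] assms by simp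
  also have "\<dots> = act M a (b, t)"
    using act_flip[of a "(b, \<not> s)"] act_flip[of "act M a (b, t)" "(b, \<not> s)"] assms
    by (cases "t = s") simp_all
  finally show ?thesis .
qed

lemma act_acts_self:
  assumes "a \<in> carrier M" "b \<in> carrier M"
  shows "act M a (self_acts M b z, t) = act M a (b, t)"
proof -
  \<comment> \<open>The start of the iteration is generalized from \<open>b\<close> to any
    \<open>c\<close> that acts as \<open>b\<close> does, a property that survives each further
    action by \<open>b\<close>.\<close>
  have "act M a (acts M c (replicate k (b, s)), t) = act M a (b, t)"
    if "c \<in> carrier M" "\<And>a t. a \<in> carrier M \<Longrightarrow> act M a (c, t) = act M a (b, t)" for c k s
    using that
  proof (induction k arbitrary: c)
    case (Suc k)
    have "act M a (act M c (b, s), t) = act M a (b, t)" if "a \<in> carrier M" for a t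
      using Suc.prems(2)[of c s] act_act_self[of a c s t] that Suc.prems by simp
    then show ?case using Suc assms by simp
  qed (use assms in simp)
  then show ?thesis using assms by (simp add: self_acts_def)
qed

text \<open>The action by \<open>y\<close> is an endomorphism and therefore commutes with taking
  self-actions of \<open>x\<close>; on the right, \<open>y\<close> and its self-action act in the
  same way.\<close>

lemma self_acts_hom: "(\<lambda>a\<in>carrier M. self_acts M a z) \<in> rack_hom M M"
proof (rule rack_homI)
  fix x y t assume xy: "x \<in> carrier M" "y \<in> carrier M"
  have "self_acts M (act M x (y, t)) z = act M (self_acts M x z) (y, t)"
    using rack_hom_self_acts[OF rack_axioms act_hom[of y t], of x z] xy by simp
  then show "(\<lambda>a\<in>carrier M. self_acts M a z) (act M x (y, t)) =
      act M ((\<lambda>a\<in>carrier M. self_acts M a z) x) ((\<lambda>a\<in>carrier M. self_acts M a z) y, t)"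
    using xy by (simp add: act_acts_self)
qed simp_all

lemma self_acts_uminus:
  assumes "a \<in> carrier M" shows "self_acts M (self_acts M a z) (- z) = a"
proof -
  let ?b = "self_acts M a z"
  \<comment> \<open>Since \<open>?b\<close> acts as \<open>a\<close> does, the undoing list may be
    taken to consist of copies of \<open>a\<close>, which cancel the original ones.\<close>
  have "acts M c (replicate k (?b, s)) = acts M c (replicate k (a, s))" if "c \<in> carrier M" for c k s
    using that by (induction k arbitrary: c) (use assms in \<open>simp_all add: act_acts_self\<close>)
  moreover have "acts M c (replicate k (a, s) @ replicate k (a, \<not> s)) = c" if "c \<in> carrier M" for c k s
    using word_acts_winv(1)[OF that, of "\<lambda>_. a" "replicate k (0, s)"] assms
    by (auto simp: word_acts_def winv_def)
  moreover have "z < 0 \<longleftrightarrow> \<not> 0 < z" if "z \<noteq> 0"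
    using that by linarith
  ultimately show ?thesis
    using assms self_acts_closed[OF assms, of z] by (cases "z = 0") (simp_all add: self_acts_def)
qed

lemma word_self_acts_aut:
  assumes "g ` fst ` set w \<subseteq> carrier M"
  shows "(\<lambda>a\<in>carrier M. word_acts M g (self_acts M a z) w) \<in> rack_aut M" (is "?f \<in> _")
proof -
  have "?f \<in> rack_hom M M"
  proof (rule rack_homI)
    fix x y t assume xy: "x \<in> carrier M" "y \<in> carrier M"
    then show "?f (act M x (y, t)) = act M (?f x) (?f y, t)"
      using rack_homD(2)[OF self_acts_hom[of z] xy, of t] assms by (simp add: word_acts_distrib)
  qed (use assms in auto)
  moreover have "bij_betw ?f (carrier M) (carrier M)"
    \<comment> \<open>The inverse undoes the word first and the self-action afterwards.\<close>
    by (rule bij_betw_byWitness[where f' = "\<lambda>a. self_acts M (word_acts M g a (winv w)) (- z)"])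
       (use assms self_acts_uminus self_acts_uminus[where z = "- z"] in \<open>auto simp: word_acts_winv\<close>)
  ultimately show ?thesis by (simp add: rack_aut_def)
qed

end

text \<open>The free group counterpart of \<open>self_acts\<close>, with the same sign convention,
  so that its action on \<open>g c\<close> unfolds to \<open>self_acts\<close>.\<close>

definition letter_power :: "'a \<Rightarrow> int \<Rightarrow> 'a word" where
  "letter_power c z = replicate (nat \<bar>z\<bar>) (c, z > 0)"

lemma letters_letter_power: "fst ` set (letter_power c z) \<subseteq> {c}"
  by (auto simp: letter_power_def)

lemma expsum_letter_power [simp]: "expsum c (letter_power c z) = z"
  by (simp add: letter_power_def expsum_replicate)

lemma expsum_letter_power_neq: "c \<noteq> d \<Longrightarrow> expsum c (letter_power d z) = 0"
  using letters_letter_power[of d z] by (intro expsum_eq_0) auto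

lemma word_acts_letter_power: "word_acts M g (g c) (letter_power c z) = self_acts M (g c) z"
  by (simp add: word_acts_def letter_power_def self_acts_def)

section \<open>Racks of words\<close>

text \<open>
  Writing \<open>g\<close> for the group element of a word, \<open>(i, g)\<close> stands for the generator \<open>i\<close> acted on by
  \<open>g\<close>, and it acts on everything by the conjugate of the letter \<open>i\<close> by \<open>g\<close>. Generators
  outside \<open>J\<close> act trivially. The injection \<open>e\<close> places the rack inside the universe.
\<close>

definition conj_word :: "nat set \<Rightarrow> nat \<Rightarrow> nat word \<Rightarrow> bool \<Rightarrow> nat word" where
  "conj_word J j v s = (if j \<in> J then winv v @ (j, s) # v else [])"

definition word_op :: "(nat \<times> nat word \<Rightarrow> 'u) \<Rightarrow> nat set \<Rightarrow> bool \<Rightarrow> 'u \<Rightarrow> 'u \<Rightarrow> 'u" where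
  "word_op e J s x y = (case (inv e x, inv e y) of
     ((i, u), (j, v)) \<Rightarrow> e (i, mul u (conj_word J j v s)))"

definition word_rack :: "(nat \<times> nat word \<Rightarrow> 'u) \<Rightarrow> nat set \<Rightarrow> nat set \<Rightarrow> 'u rack" where
  "word_rack e I J = \<lparr>carrier = e ` {(i, w). i \<in> I \<and> reduced w \<and> fst ` set w \<subseteq> J},
     rack_op = word_op e J True, rack_inv = word_op e J False\<rparr>"

text \<open>Expressing the axioms through \<open>act\<close> with a variable sign treats both
  operations at once.\<close>

lemma rackI:
  assumes "\<And>x y s. \<lbrakk>x \<in> carrier M; y \<in> carrier M\<rbrakk> \<Longrightarrow> act M x (y, s) \<in> carrier M"
    and "\<And>x y z s. \<lbrakk>x \<in> carrier M; y \<in> carrier M; z \<in> carrier M\<rbrakk> \<Longrightarrow>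
      act M (act M x (y, s)) (z, s) = act M (act M x (z, s)) (act M y (z, s), s)"
    and "\<And>x y s. \<lbrakk>x \<in> carrier M; y \<in> carrier M\<rbrakk> \<Longrightarrow> act M (act M x (y, s)) (y, \<not> s) = x"
  shows "rack M"
proof unfold_locales
  fix x y assume xy: "x \<in> carrier M" "y \<in> carrier M"
  from assms(1,3)[OF xy, of True] assms(1,3)[OF xy, of False]
  show "x \<lhd>\<^bsub>M\<^esub> y \<in> carrier M" "x \<lhd>\<inverse>\<^bsub>M\<^esub> y \<in> carrier M"
    "(x \<lhd>\<^bsub>M\<^esub> y) \<lhd>\<inverse>\<^bsub>M\<^esub> y = x" "(x \<lhd>\<inverse>\<^bsub>M\<^esub> y) \<lhd>\<^bsub>M\<^esub> y = x"
    by (simp_all add: act_def)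
  fix z assume z: "z \<in> carrier M"
  from assms(2)[OF xy z, of True] assms(2)[OF xy z, of False]
  show "(x \<lhd>\<^bsub>M\<^esub> y) \<lhd>\<^bsub>M\<^esub> z = (x \<lhd>\<^bsub>M\<^esub> z) \<lhd>\<^bsub>M\<^esub> (y \<lhd>\<^bsub>M\<^esub> z)"
    "(x \<lhd>\<inverse>\<^bsub>M\<^esub> y) \<lhd>\<inverse>\<^bsub>M\<^esub> z = (x \<lhd>\<inverse>\<^bsub>M\<^esub> z) \<lhd>\<inverse>\<^bsub>M\<^esub> (y \<lhd>\<inverse>\<^bsub>M\<^esub> z)"
    by (simp_all add: act_def)
qed

lemma act_word_rack:
  "inj e \<Longrightarrow> act (word_rack e I J) (e (i, u)) (e (j, v), s) = e (i, mul u (conj_word J j v s))"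
  by (simp add: act_def word_rack_def word_op_def)

lemma carrier_word_rack:
  "inj e \<Longrightarrow> e (i, u) \<in> carrier (word_rack e I J) \<longleftrightarrow> i \<in> I \<and> reduced u \<and> fst ` set u \<subseteq> J"
  by (auto simp: word_rack_def dest: injD)

lemma carrier_word_rackE:
  assumes "x \<in> carrier (word_rack e I J)"
  obtains i u where "x = e (i, u)" "i \<in> I" "reduced u" "fst ` set u \<subseteq> J"
  using assms by (auto simp: word_rack_def)

lemma letters_conj_word: "fst ` set v \<subseteq> J \<Longrightarrow> fst ` set (conj_word J j v s) \<subseteq> J"
  by (cases "j \<in> J") (simp_all add: conj_word_def image_Un)

lemma winv_conj_word: "winv (conj_word J j v s) = conj_word J j v (\<not> s)"
  by (simp add: conj_word_def)

lemma conj_word_mul: "conj_word J j (mul v p) s \<approx> winv p @ conj_word J j v s @ p"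
proof (cases "j \<in> J")
  case True
  have "winv (mul v p) @ [(j, s)] @ mul v p \<approx> winv (v @ p) @ [(j, s)] @ (v @ p)"
    by (intro weq_append weq_winv weq_mul weq_refl)
  then show ?thesis using True by (simp add: conj_word_def)
qed (simp add: conj_word_def weq_sym[OF weq_winv_left])

lemma rack_word_rack:
  assumes "inj e" shows "rack (word_rack e I J)"
proof (rule rackI)
  let ?W = "word_rack e I J"
  fix x y s assume "x \<in> carrier ?W" "y \<in> carrier ?W"
  then obtain i u j v
    where x: "x = e (i, u)" "i \<in> I" "reduced u" "fst ` set u \<subseteq> J"
      and y: "y = e (j, v)" "j \<in> I" "reduced v" "fst ` set v \<subseteq> J"
    by (elim carrier_word_rackE)
  let ?q = "conj_word J j v s"
  have "fst ` set ?q \<subseteq> J" by (intro letters_conj_word y(4))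
  with letters_mul[of u ?q] x(4) have "fst ` set (mul u ?q) \<subseteq> J" by blast
  then show "act ?W x (y, s) \<in> carrier ?W"
    using x y assms by (simp add: act_word_rack carrier_word_rack)
  have "mul u (?q @ winv ?q) = mul u []"
    using weq_winv_right[of ?q] x(3) by (simp only: weq_def)
  then show "act ?W (act ?W x (y, s)) (y, \<not> s) = x"
    using x y assms by (simp add: act_word_rack winv_conj_word)
  fix z assume "z \<in> carrier ?W"
  then obtain k t where z: "z = e (k, t)" by (elim carrier_word_rackE)
  let ?p = "conj_word J k t s"
  \<comment> \<open>In group terms, self-distributivity is the identity p (p\<inverse> q p) = q p
    for the two acting conjugates.\<close>
  have "?p @ conj_word J j (mul v ?p) s \<approx> ?p @ (winv ?p @ ?q @ ?p)"
    by (intro weq_append weq_refl conj_word_mul)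
  also have "\<dots> \<approx> ?q @ ?p"
    using weq_append[OF weq_winv_right[of ?p] weq_refl[of "?q @ ?p"]] by simp
  finally have "mul u (?p @ conj_word J j (mul v ?p) s) = mul u (?q @ ?p)"
    using x(3) by (simp only: weq_def)
  then show "act ?W (act ?W x (y, s)) (z, s) = act ?W (act ?W x (z, s)) (act ?W y (z, s), s)"
    using x y z assms by (simp add: act_word_rack)
qed

text \<open>Letters in \<open>A\<close> are sent to their own generators and multiply on the right;
  the others are sent to elements of trivially acting orbits and drop out. This computes components
  of an isotropy element in racks where some letters are invisible.\<close>

lemma word_acts_word_rack:
  assumes "inj e"
    and "\<And>k. k \<in> fst ` set w \<Longrightarrow> k \<in> A \<Longrightarrow> k \<in> J \<and> g k = e (k, [])"
    and "\<And>k. k \<in> fst ` set w \<Longrightarrow> k \<notin> A \<Longrightarrow> \<exists>j v. j \<notin> J \<and> g k = e (j, v)"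
  shows "word_acts (word_rack e I J) g (e (i, u)) w = e (i, mul u (filter (\<lambda>l. fst l \<in> A) w))"
  using assms(2,3)
proof (induction w arbitrary: u)
  case (Cons l w)
  obtain k s where l: "l = (k, s)" by (cases l)
  have IH: "word_acts (word_rack e I J) g (e (i, u')) w = e (i, mul u' (filter (\<lambda>l. fst l \<in> A) w))" for u'
    using Cons.prems by (intro Cons.IH) auto
  show ?case
  proof (cases "k \<in> A")
    case True
    then have "k \<in> J" "g k = e (k, [])" using Cons.prems(1)[of k] l by auto
    then show ?thesis using True l IH by (simp add: act_word_rack[OF assms(1)] conj_word_def)
  next
    case False
    then obtain j v where "j \<notin> J" "g k = e (j, v)" using Cons.prems(2)[of k] l by auto
    then show ?thesis using False l IH by (simp add: act_word_rack[OF assms(1)] conj_word_def)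
  qed
qed simp

lemma word_acts_gens:
  assumes "inj e" "fst ` set w \<subseteq> J"
  shows "word_acts (word_rack e I J) (\<lambda>k. e (k, [])) (e (i, u)) w = e (i, mul u w)"
proof -
  have "filter (\<lambda>l. fst l \<in> J) w = w"
    using assms(2) by (auto intro: filter_True)
  then show ?thesis
    using word_acts_word_rack[OF assms(1), of w J J "\<lambda>k. e (k, [])" I i u] assms(2) by auto
qed

lemma word_self_acts_gens:
  assumes "inj e" "fst ` set w \<subseteq> J" "i \<in> J"
  shows "word_acts (word_rack e I J) (\<lambda>k. e (k, [])) (self_acts (word_rack e I J) (e (i, [])) z) w =
    e (i, mul [] (letter_power i z @ w))"
proof -
  have "fst ` set (letter_power i z) \<subseteq> J"
    using letters_letter_power[of i z] assms(3) by auto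
  then have "self_acts (word_rack e I J) (e (i, [])) z = e (i, mul [] (letter_power i z))"
    using word_acts_letter_power[of _ "\<lambda>k. e (k, [])" i z] word_acts_gens[OF assms(1)] by metis
  then show ?thesis using word_acts_gens[OF assms(1,2)] by simp
qed

section \<open>Evaluation of words in an arbitrary rack\<close>

definition word_eval ::
    "(nat \<times> nat word \<Rightarrow> 'u) \<Rightarrow> nat set \<Rightarrow> 'u rack \<Rightarrow> (nat \<Rightarrow> 'u) \<Rightarrow> 'u \<Rightarrow> 'u" where
  "word_eval e I N g = (\<lambda>x\<in>carrier (word_rack e I I). case inv e x of (i, u) \<Rightarrow> word_acts N g (g i) u)"

lemma word_eval:
  "inj e \<Longrightarrow> i \<in> I \<Longrightarrow> reduced u \<Longrightarrow> fst ` set u \<subseteq> I \<Longrightarrow> word_eval e I N g (e (i, u)) = word_acts N g (g i) u"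
  by (simp add: word_eval_def carrier_word_rack)

text \<open>The existence half of the freeness of \<open>word_rack e I I\<close>. Its elements act
  by conjugates of letters, which \<open>act_word_acts\<close> matches with the action of the
  evaluated elements.\<close>

lemma word_eval_hom:
  assumes "inj e" "rack N" "g ` I \<subseteq> carrier N"
  shows "word_eval e I N g \<in> rack_hom (word_rack e I I) N"
proof (rule rack_homI)
  interpret N: rack N by fact
  let ?W = "word_rack e I I"
  have g: "g ` fst ` set w \<subseteq> carrier N" if "fst ` set w \<subseteq> I" for w :: "nat word"
    using that assms(3) by blast
  fix x assume "x \<in> carrier ?W"
  then obtain i u where x: "x = e (i, u)" "i \<in> I" "reduced u" "fst ` set u \<subseteq> I"
    by (elim carrier_word_rackE)
  have gi: "g i \<in> carrier N" using x(2) assms(3) by auto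
  show "word_eval e I N g x \<in> carrier N"
    using x assms(1) gi g[OF x(4)] by (simp add: word_eval)
  fix y s assume "y \<in> carrier ?W"
  then obtain j v where y: "y = e (j, v)" "j \<in> I" "reduced v" "fst ` set v \<subseteq> I"
    by (elim carrier_word_rackE)
  have gj: "g j \<in> carrier N" using y(2) assms(3) by auto
  let ?q = "conj_word I j v s"
  have q: "fst ` set ?q \<subseteq> I" by (intro letters_conj_word y(4))
  with letters_mul[of u ?q] x(4) have uq: "fst ` set (mul u ?q) \<subseteq> I" by blast
  have "word_eval e I N g (act ?W x (y, s)) = word_acts N g (g i) (mul u ?q)"
    using x y assms(1) uq by (simp add: act_word_rack word_eval)
  also have "\<dots> = word_acts N g (word_acts N g (g i) u) ?q"
    using N.word_acts_mul[OF gi g[OF x(4)] g[OF q]] by simp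
  also have "\<dots> = act N (word_acts N g (g i) u) (word_acts N g (g j) v, s)"
    using N.act_word_acts[of "word_acts N g (g i) u" "g j" g v s] gi gj g[OF x(4)] g[OF y(4)] y(2)
    by (simp add: conj_word_def)
  finally show "word_eval e I N g (act ?W x (y, s)) = act N (word_eval e I N g x) (word_eval e I N g y, s)"
    using x y assms(1) by (simp add: word_eval)
qed (simp add: word_eval_def)

section \<open>Isotropy of free racks\<close>

lemma free_rackD:
  assumes "free_rack R n y" shows "rack R" "i \<in> {1..n} \<Longrightarrow> y i \<in> carrier R"
  using assms by (auto simp: free_rack_def)

lemma free_rack_lift:
  assumes "free_rack R n y" "rack N" "g \<in> {1..n} \<rightarrow> carrier N"
  obtains f where "f \<in> rack_hom R N" "\<And>i. i \<in> {1..n} \<Longrightarrow> f (y i) = g i"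
  using assms unfolding free_rack_def by blast

lemma free_rack_to_word_rack:
  fixes e :: "nat \<times> nat word \<Rightarrow> 'u" and R :: "'u rack"
  assumes "inj e" "free_rack R n y" "{1..n} \<subseteq> I"
  obtains f where "f \<in> rack_hom R (word_rack e I J)" "\<And>i. i \<in> {1..n} \<Longrightarrow> f (y i) = e (i, [])"
proof -
  have "(\<lambda>i. e (i, [])) \<in> {1..n} \<rightarrow> carrier (word_rack e I J)"
    using assms(1,3) by (auto simp: carrier_word_rack)
  from free_rack_lift[OF assms(2) rack_word_rack[OF assms(1)] this] that show ?thesis by blast
qed

lemma free_rack_hom_eq:
  assumes "free_rack R n y" "rack N" "f \<in> rack_hom R N" "f' \<in> rack_hom R N"
    and "\<And>i. i \<in> {1..n} \<Longrightarrow> f (y i) = f' (y i)"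
  shows "f = f'"
proof -
  have "\<forall>g\<in>{1..n} \<rightarrow> carrier N. \<exists>!k. k \<in> rack_hom R N \<and> (\<forall>i\<in>{1..n}. k (y i) = g i)"
    by (rule assms(1)[unfolded free_rack_def, THEN conjunct2, THEN conjunct2, THEN spec[of _ N], THEN mp, OF assms(2)])
  moreover have "(\<lambda>i. f (y i)) \<in> {1..n} \<rightarrow> carrier N"
    using free_rackD(2)[OF assms(1)] rack_homD(1)[OF assms(3)] by blast
  ultimately have "\<exists>!k. k \<in> rack_hom R N \<and> (\<forall>i\<in>{1..n}. k (y i) = f (y i))"
    by (rule bspec)
  then show ?thesis using assms(3-5) by metis
qed

text \<open>The composite of the map from \<open>R\<close> to the word rack with evaluation back
  into \<open>R\<close> fixes the generators, so it is the identity by freeness; every element of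
  \<open>R\<close> is thus the value of a word.\<close>

lemma free_rack_generated:
  fixes e :: "nat \<times> nat word \<Rightarrow> 'u" and R :: "'u rack"
  assumes "inj e" "free_rack R n y" "a \<in> carrier R"
  obtains i w where "i \<in> {1..n}" "fst ` set w \<subseteq> {1..n}" "a = word_acts R y (y i) w"
proof -
  let ?F = "word_rack e {1..n} {1..n}"
  have R: "rack R" "y ` {1..n} \<subseteq> carrier R" using free_rackD[OF assms(2)] by blast+
  have F: "rack ?F" by (rule rack_word_rack[OF assms(1)])
  obtain f where f: "f \<in> rack_hom R ?F" "\<And>i. i \<in> {1..n} \<Longrightarrow> f (y i) = e (i, [])"
    by (rule free_rack_to_word_rack[OF assms(1,2), where I = "{1..n}" and J = "{1..n}"]) auto
  let ?v = "word_eval e {1..n} R y"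
  have v: "?v \<in> rack_hom ?F R" by (intro word_eval_hom assms R)
  have "compose (carrier R) ?v f = restrict id (carrier R)"
  proof (rule free_rack_hom_eq[OF assms(2) R(1) rack_hom_compose[OF R(1) f(1) v] rack_hom_id[OF R(1)]])
    fix i assume "i \<in> {1..n}"
    moreover from this have "y i \<in> carrier R" using R(2) by auto
    ultimately show "compose (carrier R) ?v f (y i) = restrict id (carrier R) (y i)"
      using f(2) assms(1) by (simp add: compose_def word_eval)
  qed
  then have "?v (f a) = a" using assms(3) by (metis compose_eq id_apply restrict_apply')
  moreover obtain i w where "f a = e (i, w)" "i \<in> {1..n}" "reduced w" "fst ` set w \<subseteq> {1..n}"
    using rack_homD(1)[OF f(1) assms(3)] by (elim carrier_word_rackE)
  ultimately show ?thesis using that[of i w] assms(1) by (simp add: word_eval)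
qed

section \<open>Families given by an integer and a word\<close>

definition word_form :: "'u rack \<Rightarrow> nat \<Rightarrow> (nat \<Rightarrow> 'u) \<Rightarrow> 'u rack_family \<Rightarrow> int \<Rightarrow> nat word \<Rightarrow> bool" where
  "word_form R n y \<pi> z w \<longleftrightarrow> w \<in> reduced_words n \<and>
     (\<forall>N h. rack N \<longrightarrow> h \<in> rack_hom R N \<longrightarrow>
        (\<forall>r\<in>carrier N. \<pi> N h r = word_acts N (\<lambda>i. h (y i)) (self_acts N r z) w))"

text \<open>The formula defines an automorphism of every codomain, and it is natural because
  homomorphisms commute with self-actions and with word actions.\<close>

lemma word_form_isotropy:
  assumes "free_rack R n y" "endo_family R \<pi>" "word_form R n y \<pi> z w"
  shows "\<pi> \<in> isotropy R"
proof -
  have R: "rack R" "y ` {1..n} \<subseteq> carrier R" using free_rackD[OF assms(1)] by blast+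
  have w: "fst ` set w \<subseteq> {1..n}" using assms(3) by (simp add: word_form_def reduced_words_iff)
  have letters: "(\<lambda>i. h (y i)) ` fst ` set w \<subseteq> carrier N" if "h \<in> rack_hom R N" for N h
    using w R(2) rack_homD(1)[OF that] by blast
  have \<pi>: "\<pi> N h = (\<lambda>r\<in>carrier N. word_acts N (\<lambda>i. h (y i)) (self_acts N r z) w)"
    if "rack N" "h \<in> rack_hom R N" for N h
  proof
    fix r
    have "\<pi> N h \<in> extensional (carrier N)"
      using assms(2) that by (auto simp: endo_family_def intro: rack_homD(3))
    then show "\<pi> N h r = (\<lambda>r\<in>carrier N. word_acts N (\<lambda>i. h (y i)) (self_acts N r z) w) r"
      using assms(3) that by (auto simp: word_form_def extensional_def)
  qed
  have "\<pi> N h \<in> rack_aut N" if "rack N" "h \<in> rack_hom R N" for N h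
    using rack.word_self_acts_aut[OF that(1) letters[OF that(2)]] that by (simp add: \<pi>)
  moreover have "compose (carrier N) h' (\<pi> N h) =
      compose (carrier N) (\<pi> N' (compose (carrier R) h' h)) h'"
    if "rack N" "rack N'" "h \<in> rack_hom R N" "h' \<in> rack_hom N N'" for N N' h h'
  proof
    fix a
    have c: "word_acts N' (\<lambda>i. compose (carrier R) h' h (y i)) b w = word_acts N' (\<lambda>i. h' (h (y i))) b w" for b
      by (rule word_acts_cong) (use w R(2) in \<open>auto simp: compose_def\<close>)
    show "compose (carrier N) h' (\<pi> N h) a = compose (carrier N) (\<pi> N' (compose (carrier R) h' h)) h' a"
    proof (cases "a \<in> carrier N")
      case True
      then show ?thesis
        using that rack_homD(1)[OF that(4)] letters[OF that(3)]
        by (simp add: compose_eq \<pi> rack_hom_compose[OF R(1)] c rack_hom_word_acts rack_hom_self_acts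
            rack.self_acts_closed)
    qed (simp add: compose_def)
  qed
  ultimately show ?thesis by (simp add: isotropy_def)
qed

text \<open>In the word rack with an extra generator 0, the value at that generator records the
  group element of \<open>letter_power 0 z @ w\<close>. As 0 does not occur in \<open>w\<close>, the
  exponent sum of 0 is \<open>z\<close>; left cancellation then determines \<open>w\<close>.\<close>

lemma word_form_unique:
  fixes e :: "nat \<times> nat word \<Rightarrow> 'u" and R :: "'u rack"
  assumes "inj e" "free_rack R n y" "word_form R n y \<pi> z w" "word_form R n y \<pi> z' w'"
  shows "z = z' \<and> w = w'"
proof -
  let ?F = "word_rack e {0..n} {0..n}"
  have F: "rack ?F" by (rule rack_word_rack[OF assms(1)])
  obtain f where f: "f \<in> rack_hom R ?F" "\<And>i. i \<in> {1..n} \<Longrightarrow> f (y i) = e (i, [])"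
    by (rule free_rack_to_word_rack[OF assms(1,2), where I = "{0..n}" and J = "{0..n}"]) auto
  have *: "\<pi> ?F f (e (0, [])) = e (0, mul [] (letter_power 0 z @ w)) \<and> reduced w \<and> expsum 0 w = 0"
    if "word_form R n y \<pi> z w" for z w
  proof -
    have w: "fst ` set w \<subseteq> {1..n}" "reduced w"
      using that by (simp_all add: word_form_def reduced_words_iff)
    then have w0: "fst ` set w \<subseteq> {0..n}" "0 \<notin> fst ` set w"
      using atLeastAtMost_iff[of 0 1 n] by fastforce+
    have "\<pi> ?F f (e (0, [])) = word_acts ?F (\<lambda>i. f (y i)) (self_acts ?F (e (0, [])) z) w"
      using that F f(1) assms(1) by (simp add: word_form_def carrier_word_rack)
    also have "\<dots> = word_acts ?F (\<lambda>i. e (i, [])) (self_acts ?F (e (0, [])) z) w"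
      by (rule word_acts_cong) (use w f(2) in blast)
    finally show ?thesis
      using word_self_acts_gens[OF assms(1) w0(1)] w(2) expsum_eq_0[OF w0(2)] by simp
  qed
  have "e (0, mul [] (letter_power 0 z @ w)) = e (0, mul [] (letter_power 0 z' @ w'))"
    using *[OF assms(3)] *[OF assms(4)] by simp
  then have eq: "letter_power 0 z @ w \<approx> letter_power 0 z' @ w'"
    using assms(1) by (auto simp: weq_iff dest!: injD)
  then have "z = z'"
    using *[OF assms(3)] *[OF assms(4)] expsum_weq[OF eq, of 0] by simp
  with eq have "w \<approx> w'" using weq_cancel_left by blast
  with \<open>z = z'\<close> show ?thesis using *[OF assms(3)] *[OF assms(4)] weq_reduced_eq by blast
qed

lemma isotropyD:
  assumes "\<pi> \<in> isotropy M"
  shows "\<lbrakk>rack N; h \<in> rack_hom M N\<rbrakk> \<Longrightarrow> \<pi> N h \<in> rack_aut N"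
    and "\<lbrakk>rack N; rack N'; h \<in> rack_hom M N; h' \<in> rack_hom N N'\<rbrakk> \<Longrightarrow>
      compose (carrier N) h' (\<pi> N h) = compose (carrier N) (\<pi> N' (compose (carrier M) h' h)) h'"
  using assms by (simp_all add: isotropy_def)

lemma isotropy_word_form:
  fixes e :: "nat \<times> nat word \<Rightarrow> 'u" and R :: "'u rack"
  assumes e: "inj e" and free: "free_rack R n y" and iso: "\<pi> \<in> isotropy R"
  obtains z w where "word_form R n y \<pi> z w"
proof -
  \<comment> \<open>The word model of \<open>R\<close> with the extra generator 0 adjoined;
    \<open>?x\<close> is its letter.\<close>
  let ?F = "word_rack e {0..n} {0..n}"
  let ?x = "(0, True)"
  note R = free_rackD[OF free]
  have F: "rack ?F" by (rule rack_word_rack[OF e])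
  obtain f where f: "f \<in> rack_hom R ?F" "\<And>i. i \<in> {1..n} \<Longrightarrow> f (y i) = e (i, [])"
    by (rule free_rack_to_word_rack[OF e free, where I = "{0..n}" and J = "{0..n}"]) auto
  note aut = isotropyD(1)[OF iso]
  have gen0: "e (0, []) \<in> carrier ?F" using e by (simp add: carrier_word_rack)
  have "\<pi> ?F f (e (0, [])) \<in> carrier ?F"
    using aut[OF F f(1)] gen0 by (auto simp: rack_aut_def dest: rack_homD(1))
  then obtain j g where jg: "\<pi> ?F f (e (0, [])) = e (j, g)" "j \<in> {0..n}" "reduced g" "fst ` set g \<subseteq> {0..n}"
    by (elim carrier_word_rackE)
  \<comment> \<open>The assignment on \<open>{0..n}\<close> that follows \<open>h\<close> on the old
    generators and sends the extra generator to \<open>r\<close>.\<close>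
  define G :: "'u rack \<Rightarrow> ('u \<Rightarrow> 'u) \<Rightarrow> 'u \<Rightarrow> nat \<Rightarrow> 'u"
    where "G N h r = (\<lambda>i. h (y i))(0 := r)" for N h r
  have G: "G N h r ` {0..n} \<subseteq> carrier N" if "h \<in> rack_hom R N" "r \<in> carrier N" for N h r
    using rack_homD(1)[OF that(1)] R(2) that(2) by (auto simp: G_def)
  \<comment> \<open>Evaluation along \<open>G N h r\<close> is a morphism from \<open>?F\<close> to
    \<open>N\<close> that restricts to \<open>h\<close> along \<open>f\<close> and sends generator 0
    to \<open>r\<close>. Naturality along it carries the value at generator 0 to the value of the
    component at \<open>r\<close>.\<close>
  have eval: "\<pi> N h r = word_acts N (G N h r) (G N h r j) g"
    if N: "rack N" and h: "h \<in> rack_hom R N" and r: "r \<in> carrier N" for N h r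
  proof -
    let ?v = "word_eval e {0..n} N (G N h r)"
    have v: "?v \<in> rack_hom ?F N" by (intro word_eval_hom e N G h r)
    have "compose (carrier R) ?v f = h"
    proof (rule free_rack_hom_eq[OF free N rack_hom_compose[OF R(1) f(1) v] h])
      fix i assume i: "i \<in> {1..n}"
      then show "compose (carrier R) ?v f (y i) = h (y i)"
        using f(2)[OF i] R(2)[OF i] e by (simp add: compose_eq word_eval G_def)
    qed
    then have "compose (carrier ?F) ?v (\<pi> ?F f) = compose (carrier ?F) (\<pi> N h) ?v"
      using isotropyD(2)[OF iso F N f(1) v] by simp
    then have "?v (\<pi> ?F f (e (0, []))) = \<pi> N h (?v (e (0, [])))"
      by (drule_tac fun_cong[where x = "e (0, [])"]) (simp only: compose_eq[OF gen0])
    then show ?thesis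
      using jg e by (simp add: word_eval G_def)
  qed
  have j0: "j = 0"
  proof (rule ccontr)
    assume j: "j \<noteq> 0"
    \<comment> \<open>Without letters only empty words remain, so this rack has two elements and
      trivial operations. For \<open>j\<close> other than 0 the component would send both to
      \<open>h (y j)\<close>, contradicting injectivity.\<close>
    let ?T = "word_rack e {0, 1} {}"
    have T: "rack ?T" by (rule rack_word_rack[OF e])
    have gens: "e (0, []) \<in> carrier ?T" "e (1, []) \<in> carrier ?T"
      using e by (simp_all add: carrier_word_rack)
    then obtain h where h: "h \<in> rack_hom R ?T"
      by (auto intro: free_rack_lift[OF free T, of "\<lambda>_. e (0, [])"])
    have "y j \<in> carrier R" using R(2) jg(2) j by simp
    then have "h (y j) \<in> carrier ?T" by (rule rack_homD(1)[OF h])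
    then obtain i u where hj: "h (y j) = e (i, u)"
      by (elim carrier_word_rackE)
    have "\<pi> ?T h r = e (i, u)" if r: "r \<in> carrier ?T" for r
    proof -
      have "\<exists>i v. i \<notin> {} \<and> G ?T h r k = e (i, v)" if "k \<in> fst ` set g" for k
      proof -
        have "G ?T h r k \<in> carrier ?T" using G[OF h r] jg(4) that by blast
        then show ?thesis by (elim carrier_word_rackE) blast
      qed
      then show ?thesis
        using eval[OF T h r] word_acts_word_rack[OF e, of g "{}" "{}" "G ?T h r"] hj j by (simp add: G_def)
    qed
    then have "\<pi> ?T h (e (0, [])) = \<pi> ?T h (e (1, []))" using gens by simp
    then have "e (0, []) = e (1, [])"
      using aut[OF T h] gens by (auto simp: rack_aut_def bij_betw_def dest: inj_onD)
    then show False using e by (auto dest: injD)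
  qed
  \<comment> \<open>The normal form of \<open>g\<close> with the letter 0 deleted; it will be the
    word of the formula.\<close>
  define w where "w = mul [] (filter (\<lambda>l. fst l \<in> {1..n}) g)"
  have w: "reduced w" "fst ` set w \<subseteq> {1..n}"
    using letters_mul[of "[]" "filter (\<lambda>l. fst l \<in> {1..n}) g"] by (auto simp: w_def)
  \<comment> \<open>In the rack below the generator \<open>Suc n\<close> is not a letter, so its orbit acts trivially.\<close>
  have centr: "?x # w \<approx> w @ winv g @ ?x # g"
  proof -
    let ?W = "word_rack e {0..Suc n} {0..n}"
    have W: "rack ?W" by (rule rack_word_rack[OF e])
    obtain h where h: "h \<in> rack_hom R ?W" "\<And>i. i \<in> {1..n} \<Longrightarrow> h (y i) = e (i, [])"
      by (rule free_rack_to_word_rack[OF e free, where I = "{0..Suc n}" and J = "{0..n}"]) auto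
    \<comment> \<open>Evaluating at an element of the orbit of \<open>Suc n\<close> makes letter 0
      stand for that element, which acts trivially; only the letters in \<open>{1..n}\<close> remain
      effective.\<close>
    have trivial: "\<pi> ?W h (e (Suc n, u)) = e (Suc n, mul u (filter (\<lambda>l. fst l \<in> {1..n}) g))"
      if "e (Suc n, u) \<in> carrier ?W" for u
    proof -
      let ?G = "G ?W h (e (Suc n, u))"
      have "word_acts ?W ?G (e (Suc n, u)) g = e (Suc n, mul u (filter (\<lambda>l. fst l \<in> {1..n}) g))"
      proof (rule word_acts_word_rack[OF e])
        fix k assume k: "k \<in> fst ` set g"
        show "k \<in> {0..n} \<and> ?G k = e (k, [])" if "k \<in> {1..n}"
          using that h(2) by (simp add: G_def)
        show "\<exists>j v. j \<notin> {0..n} \<and> ?G k = e (j, v)" if "k \<notin> {1..n}"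
        proof -
          have "k \<in> {0..n}" using k jg(4) by blast
          with that have "?G k = e (Suc n, u)" by (simp add: G_def)
          then show ?thesis by (intro exI[of _ "Suc n"] exI[of _ u]) simp
        qed
      qed
      then show ?thesis using eval[OF W h(1) that] j0 by (simp add: G_def)
    qed
    have "\<pi> ?W h (e (0, [])) = word_acts ?W (G ?W h (e (0, []))) (e (0, [])) g"
      using eval[OF W h(1), of "e (0, [])"] j0 e by (simp add: carrier_word_rack G_def)
    also have "\<dots> = word_acts ?W (\<lambda>k. e (k, [])) (e (0, [])) g"
      using jg(4) h(2) by (intro word_acts_cong) (auto simp: G_def)
    also have "\<dots> = e (0, g)"
      using word_acts_gens[OF e jg(4)] jg(3) by (simp add: mul_Nil_reduced)
    finally have \<pi>0: "\<pi> ?W h (e (0, [])) = e (0, g)" .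
    have c: "e (0, []) \<in> carrier ?W" "e (Suc n, []) \<in> carrier ?W" "e (Suc n, [?x]) \<in> carrier ?W"
      using e by (simp_all add: carrier_word_rack reduced_Cons)
    \<comment> \<open>The homomorphism law on generator \<open>Suc n\<close> acted on by generator
      0: the left side yields the word of \<open>?x\<close> and \<open>w\<close>, the right side
      \<open>w\<close> followed by the conjugate of \<open>?x\<close> by \<open>g\<close>.\<close>
    have "\<pi> ?W h (act ?W (e (Suc n, [])) (e (0, []), True)) =
        act ?W (\<pi> ?W h (e (Suc n, []))) (\<pi> ?W h (e (0, [])), True)"
      using aut[OF W h(1)] c by (auto simp: rack_aut_def dest: rack_homD(2))
    then have "e (Suc n, mul [?x] (filter (\<lambda>l. fst l \<in> {1..n}) g)) = e (Suc n, mul w (winv g @ ?x # g))"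
      using trivial[OF c(2)] trivial[OF c(3)] \<pi>0
      by (simp add: act_word_rack[OF e] conj_word_def w_def mul_letter_def)
    then have eq: "mul [?x] (filter (\<lambda>l. fst l \<in> {1..n}) g) = mul w (winv g @ ?x # g)"
      using e by (auto dest: injD)
    have "[?x] @ w \<approx> [?x] @ filter (\<lambda>l. fst l \<in> {1..n}) g"
      unfolding w_def by (intro weq_append weq_refl weq_reduce)
    also have "\<dots> \<approx> mul w (winv g @ ?x # g)"
      unfolding eq[symmetric] by (intro weq_sym[OF weq_mul])
    also have "\<dots> \<approx> w @ winv g @ ?x # g" by (rule weq_mul)
    finally show ?thesis by simp
  qed
  define u where "u = mul [] (g @ winv w)"
  have u: "u \<approx> g @ winv w" unfolding u_def by (rule weq_reduce)
  have "fst ` set u \<subseteq> {0}"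
  proof (rule centralizer_letter)
    show "reduced u" by (simp add: u_def)
    \<comment> \<open>Multiplying \<open>centr\<close> by \<open>g @ winv w\<close> on the left and
      by \<open>winv w\<close> on the right turns it into the statement that
      \<open>g @ winv w\<close> commutes with \<open>?x\<close>.\<close>
    have "(g @ winv w) @ (?x # w) @ winv w \<approx> (g @ winv w) @ (w @ winv g @ ?x # g) @ winv w"
      by (intro weq_append weq_refl centr)
    also have "\<dots> \<approx> g @ [] @ (winv g @ ?x # g) @ winv w"
      using weq_append[OF weq_refl[of g] weq_append[OF weq_winv_left[of w] weq_refl]] by simp
    also have "\<dots> \<approx> [] @ [?x] @ (g @ winv w)"
      using weq_append[OF weq_winv_right[of g] weq_refl] by simp
    finally have 1: "(g @ winv w) @ [?x] @ (w @ winv w) \<approx> [?x] @ (g @ winv w)" by simp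
    have "[?x] @ u \<approx> [?x] @ (g @ winv w)"
      by (intro weq_append weq_refl u)
    also have "\<dots> \<approx> (g @ winv w) @ [?x] @ (w @ winv w)"
      by (rule weq_sym[OF 1])
    also have "\<dots> \<approx> u @ [?x] @ []"
      by (intro weq_append weq_refl weq_sym[OF u] weq_winv_right)
    finally show "?x # u \<approx> u @ [?x]" by simp
  qed
  have "u @ w \<approx> (g @ winv w) @ w"
    by (intro weq_append weq_refl u)
  also have "\<dots> \<approx> g @ []"
    using weq_append[OF weq_refl[of g] weq_winv_left[of w]] by simp
  finally have g: "g \<approx> u @ w" by (simp add: weq_sym)
  \<comment> \<open>All letters of \<open>u\<close> are 0, which \<open>G\<close> sends to the
    argument \<open>r\<close>; so \<open>u\<close> contributes self-actions whose total is its
    exponent sum.\<close>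
  have "word_form R n y \<pi> (expsum 0 u) w"
    unfolding word_form_def reduced_words_iff
  proof (intro conjI allI impI ballI w)
    fix N h r assume N: "rack N" and h: "h \<in> rack_hom R N" and r: "r \<in> carrier N"
    have letters: "G N h r ` fst ` set v \<subseteq> carrier N" if "fst ` set v \<subseteq> {0..n}" for v :: "nat word"
      using G[OF h r] that by blast
    have "fst ` set (u @ w) \<subseteq> {0..n}"
      using \<open>fst ` set u \<subseteq> {0}\<close> w(2) by force
    then have "\<pi> N h r = word_acts N (G N h r) r (u @ w)"
      using eval[OF N h r] j0 rack.word_acts_weq[OF N g r letters[OF jg(4)] letters] by (simp add: G_def)
    also have "\<dots> = word_acts N (G N h r) (self_acts N r (expsum 0 u)) w"
      using rack.word_acts_self[OF N r \<open>fst ` set u \<subseteq> {0}\<close>, of "G N h r"] by (simp add: G_def)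
    also have "\<dots> = word_acts N (\<lambda>i. h (y i)) (self_acts N r (expsum 0 u)) w"
      using w(2) by (intro word_acts_cong) (auto simp: G_def)
    finally show "\<pi> N h r = word_acts N (\<lambda>i. h (y i)) (self_acts N r (expsum 0 u)) w" .
  qed
  then show ?thesis by (rule that)
qed

section \<open>Inner automorphisms of the free rack\<close>

lemma acts_eq_word_acts:
  fixes e :: "nat \<times> nat word \<Rightarrow> 'u" and R :: "'u rack"
  assumes "inj e" "free_rack R n y" "fst ` set bs \<subseteq> carrier R"
  shows "\<exists>w. fst ` set w \<subseteq> {1..n} \<and> (\<forall>a\<in>carrier R. acts R a bs = word_acts R y a w)"
  using assms(3)
proof (induction bs)
  case Nil
  show ?case by (rule exI[of _ "[]"]) simp
next
  case (Cons l bs)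
  interpret rack R by (rule free_rackD[OF assms(2)])
  obtain b s where l: "l = (b, s)" by (cases l)
  have b: "b \<in> carrier R" using Cons.prems l by simp
  obtain i v where v: "i \<in> {1..n}" "fst ` set v \<subseteq> {1..n}" "b = word_acts R y (y i) v"
    using free_rack_generated[OF assms(1,2) b] .
  obtain w where w: "fst ` set w \<subseteq> {1..n}" "\<forall>a\<in>carrier R. acts R a bs = word_acts R y a w"
    using Cons by auto
  have yi: "y i \<in> carrier R" and yv: "y ` fst ` set v \<subseteq> carrier R"
    using free_rackD(2)[OF assms(2)] v(1,2) by blast+
  show ?case
  \<comment> \<open>The first acting element is generator \<open>i\<close> moved by
    \<open>v\<close>, so by conjugation its action is that of a word in the generators,
    independently of \<open>a\<close>.\<close>
  proof (intro exI[of _ "winv v @ [(i, s)] @ v @ w"] conjI ballI)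
    show "fst ` set (winv v @ [(i, s)] @ v @ w) \<subseteq> {1..n}"
      using v(1,2) w(1) by (simp add: image_Un)
    fix a assume a: "a \<in> carrier R"
    have "act R a l = word_acts R y a (winv v @ [(i, s)] @ v)"
      using act_word_acts[OF a yi yv] l v(3) by simp
    moreover have "act R a l \<in> carrier R" using a b l by simp
    ultimately show "acts R a (l # bs) = word_acts R y a (winv v @ [(i, s)] @ v @ w)"
      using w(2) by simp
  qed
qed

lemma categorical_inner_iff:
  fixes e :: "nat \<times> nat word \<Rightarrow> 'u" and R :: "'u rack"
  assumes "inj e" "free_rack R n y" "h \<in> rack_hom R R"
  shows "categorical_inner R h \<longleftrightarrow>
    (\<exists>z w. w \<in> reduced_words n \<and> (\<forall>a\<in>carrier R. h a = word_acts R y (self_acts R a z) w))"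
proof
  let ?id = "restrict id (carrier R)"
  note R = free_rackD[OF assms(2)]
  have id: "?id \<in> rack_hom R R" by (rule rack_hom_id[OF R(1)])
  have id_y: "word_acts R (\<lambda>i. ?id (y i)) a w = word_acts R y a w" if "w \<in> reduced_words n" for a w
    using that R(2) by (intro word_acts_cong) (auto simp: reduced_words_iff)
  {
    assume "categorical_inner R h"
    then obtain \<pi> where \<pi>: "\<pi> \<in> isotropy R" "h = \<pi> R ?id"
      by (auto simp: categorical_inner_def)
    obtain z w where zw: "word_form R n y \<pi> z w"
      using isotropy_word_form[OF assms(1,2) \<pi>(1)] .
    then have "w \<in> reduced_words n" by (simp add: word_form_def)
    moreover have "h a = word_acts R y (self_acts R a z) w" if "a \<in> carrier R" for a
      using zw R(1) id that id_y[OF \<open>w \<in> reduced_words n\<close>] by (simp add: word_form_def \<pi>(2))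
    ultimately show "\<exists>z w. w \<in> reduced_words n \<and> (\<forall>a\<in>carrier R. h a = word_acts R y (self_acts R a z) w)"
      by blast
  next
    assume "\<exists>z w. w \<in> reduced_words n \<and> (\<forall>a\<in>carrier R. h a = word_acts R y (self_acts R a z) w)"
    then obtain z w where w: "w \<in> reduced_words n"
      and hw: "\<And>a. a \<in> carrier R \<Longrightarrow> h a = word_acts R y (self_acts R a z) w" by blast
    \<comment> \<open>The formula for \<open>h\<close> makes sense for every morphism out of
      \<open>R\<close> and thereby extends \<open>h\<close> to a family whose component at the
      identity is \<open>h\<close>.\<close>
    define \<pi> :: "'u rack_family"
      where "\<pi> = (\<lambda>N k. \<lambda>r\<in>carrier N. word_acts N (\<lambda>i. k (y i)) (self_acts N r z) w)"
    have "endo_family R \<pi>"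
      unfolding endo_family_def
    proof (intro allI impI)
      fix N k assume N: "rack N" and k: "k \<in> rack_hom R N"
      have "(\<lambda>i. k (y i)) ` fst ` set w \<subseteq> carrier N"
        using w R(2) rack_homD(1)[OF k] by (auto simp: reduced_words_iff)
      from rack.word_self_acts_aut[OF N this] show "\<pi> N k \<in> rack_hom N N"
        by (simp add: \<pi>_def rack_aut_def)
    qed
    moreover have "word_form R n y \<pi> z w"
      using w by (simp add: word_form_def \<pi>_def)
    ultimately have \<pi>: "\<pi> \<in> isotropy R" by (rule word_form_isotropy[OF assms(2)])
    have "h = \<pi> R ?id"
    proof
      fix a show "h a = \<pi> R ?id a"
        using hw id_y[OF w] rack_homD(3)[OF assms(3)] by (simp add: \<pi>_def extensional_def)
    qed
    with \<pi> isotropyD(1)[OF \<pi> R(1) id] show "categorical_inner R h"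
      by (auto simp: categorical_inner_def)
  }
qed

text \<open>
  With one generator \<open>y\<close> every element acts as \<open>y\<close> does, so \<open>a \<lhd> a = a \<lhd> y\<close> for all \<open>a\<close>;
  two generators are needed to tell \<open>z\<close> and \<open>w\<close> apart inside \<open>R\<close>.
\<close>

lemma word_value_unique:
  fixes e :: "nat \<times> nat word \<Rightarrow> 'u" and R :: "'u rack"
  assumes "inj e" "free_rack R n y" "n \<ge> 2" "w \<in> reduced_words n" "w' \<in> reduced_words n"
    and eq: "\<And>a. a \<in> carrier R \<Longrightarrow>
      word_acts R y (self_acts R a z) w = word_acts R y (self_acts R a z') w'"
  shows "z = z' \<and> w = w'"
proof -
  let ?F = "word_rack e {1..n} {1..n}"
  note R = free_rackD[OF assms(2)]
  obtain f where f: "f \<in> rack_hom R ?F" "\<And>i. i \<in> {1..n} \<Longrightarrow> f (y i) = e (i, [])"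
    by (rule free_rack_to_word_rack[OF assms(1,2), where I = "{1..n}" and J = "{1..n}"]) auto
  have image: "f (word_acts R y (self_acts R (y i) z) w) = e (i, mul [] (letter_power i z @ w))"
    if i: "i \<in> {1..n}" and w: "fst ` set w \<subseteq> {1..n}" for i z w
  proof -
    have "y ` fst ` set w \<subseteq> carrier R" using w R(2) by blast
    then have "f (word_acts R y (self_acts R (y i) z) w) =
        word_acts ?F (\<lambda>k. f (y k)) (self_acts ?F (f (y i)) z) w"
      using R(2)[OF i]
      by (simp add: rack_hom_word_acts[OF R(1) f(1)] rack_hom_self_acts[OF R(1) f(1)]
          rack.self_acts_closed[OF R(1)])
    also have "\<dots> = word_acts ?F (\<lambda>k. e (k, [])) (self_acts ?F (e (i, [])) z) w"
      unfolding f(2)[OF i] by (rule word_acts_cong) (use w f(2) in blast)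
    finally show ?thesis using word_self_acts_gens[OF assms(1) w i] by simp
  qed
  have w: "fst ` set w \<subseteq> {1..n}" "fst ` set w' \<subseteq> {1..n}" "reduced w" "reduced w'"
    using assms(4,5) by (simp_all add: reduced_words_iff)
  have weq: "letter_power i z @ w \<approx> letter_power i z' @ w'" if "i \<in> {1..n}" for i
  proof -
    have "e (i, mul [] (letter_power i z @ w)) = e (i, mul [] (letter_power i z' @ w'))"
      using image[OF that w(1)] image[OF that w(2)] eq[OF R(2)[OF that]] by metis
    then show ?thesis using assms(1) by (auto simp: weq_iff dest!: injD)
  qed
  have 12: "1 \<in> {1..n}" "2 \<in> {1..n}" using assms(3) by auto
  \<comment> \<open>At generator 2 the self-actions contribute nothing to the exponent sum of letter
    1, which compares the words alone; the same sum at generator 1 then isolates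
    \<open>z\<close>.\<close>
  have "expsum 1 w = expsum 1 w'"
    using expsum_weq[OF weq[OF 12(2)], of 1] by (simp add: expsum_letter_power_neq)
  then have "z = z'"
    using expsum_weq[OF weq[OF 12(1)], of 1] by simp
  with weq[OF 12(1)] have "w \<approx> w'" using weq_cancel_left by blast
  with \<open>z = z'\<close> w show ?thesis using weq_reduced_eq by blast
qed

lemma algebraic_inner_iff:
  fixes e :: "nat \<times> nat word \<Rightarrow> 'u" and R :: "'u rack"
  assumes "inj e" "free_rack R n y" "h \<in> rack_aut R"
  shows "algebraic_inner R h \<longleftrightarrow>
    (\<exists>z w. w \<in> reduced_words n \<and> (\<forall>a\<in>carrier R. h a = word_acts R y (self_acts R a z) w))"
proof
  interpret rack R by (rule free_rackD[OF assms(2)])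
  {
    assume "algebraic_inner R h"
    then obtain \<delta>s rs where rs: "fst ` set rs \<subseteq> carrier R"
      and h: "\<And>r. r \<in> carrier R \<Longrightarrow> h r = acts R r (map (\<lambda>\<delta>. (r, \<delta>)) \<delta>s @ rs)"
      by (auto simp: algebraic_inner_def)
    obtain w where w: "fst ` set w \<subseteq> {1..n}" "\<forall>a\<in>carrier R. acts R a rs = word_acts R y a w"
      using acts_eq_word_acts[OF assms(1,2) rs] by blast
    \<comment> \<open>A word in one auxiliary letter standing for the argument; its exponent sum
      condenses the signs into one integer.\<close>
    let ?p = "map (Pair (0::nat)) \<delta>s"
    have mw: "fst ` set (mul [] w) \<subseteq> {1..n}"
      using letters_mul[of "[]" w] w(1) by auto
    have yw: "y ` fst ` set w \<subseteq> carrier R"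
      using free_rackD(2)[OF assms(2)] w(1) by blast
    have "h a = word_acts R y (self_acts R a (expsum 0 ?p)) (mul [] w)" if a: "a \<in> carrier R" for a
    proof -
      have "acts R a (map (\<lambda>\<delta>. (a, \<delta>)) \<delta>s) = word_acts R (\<lambda>_. a) a ?p"
        by (simp add: word_acts_def comp_def)
      also have "\<dots> = self_acts R a (expsum 0 ?p)"
        by (rule word_acts_self[OF a]) auto
      finally have "h a = word_acts R y (self_acts R a (expsum 0 ?p)) w"
        using h[OF a] w(2) a by simp
      then show ?thesis
        using word_acts_mul[of "self_acts R a (expsum 0 ?p)" y "[]" w] a yw by simp
    qed
    moreover have "mul [] w \<in> reduced_words n"
      using mw by (simp add: reduced_words_iff)
    ultimately show "\<exists>z w. w \<in> reduced_words n \<and> (\<forall>a\<in>carrier R. h a = word_acts R y (self_acts R a z) w)"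
      by blast
  next
    assume "\<exists>z w. w \<in> reduced_words n \<and> (\<forall>a\<in>carrier R. h a = word_acts R y (self_acts R a z) w)"
    then obtain z w where w: "w \<in> reduced_words n"
      and h: "\<And>a. a \<in> carrier R \<Longrightarrow> h a = word_acts R y (self_acts R a z) w" by blast
    let ?rs = "map (\<lambda>(i, s). (y i, s)) w"
    have "fst ` set ?rs = y ` fst ` set w" by (simp add: image_image case_prod_unfold)
    also have "\<dots> \<subseteq> carrier R"
      using w free_rackD(2)[OF assms(2)] by (auto simp: reduced_words_iff)
    finally have "fst ` set ?rs \<subseteq> carrier R" .
    moreover have "h r = acts R r (map (\<lambda>\<delta>. (r, \<delta>)) (replicate (nat \<bar>z\<bar>) (z > 0)) @ ?rs)"
      if "r \<in> carrier R" for r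
      using h[OF that] by (simp add: word_acts_def self_acts_def)
    ultimately show "algebraic_inner R h"
      using assms(3) unfolding algebraic_inner_def by blast
  }
qed

theorem corollary4p12:
  fixes R :: "'u rack" and n :: nat and y :: "nat \<Rightarrow> 'u"
  assumes "infinite (UNIV :: 'u set)"
    and "free_rack R n y"
  shows
    "(\<forall>\<pi>. endo_family R \<pi> \<longrightarrow>
        (\<pi> \<in> isotropy R \<longleftrightarrow>
          (\<exists>!zw. case zw of (z, w) \<Rightarrow> w \<in> reduced_words n \<and>
             (\<forall>N h. rack N \<longrightarrow> h \<in> rack_hom R N \<longrightarrow>
               (\<forall>r\<in>carrier N. \<pi> N h r = word_acts N (\<lambda>i. h (y i)) (self_acts N r z) w)))))
     \<and>
     (\<forall>h \<in> rack_hom R R.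
        (categorical_inner R h \<longleftrightarrow>
          (\<exists>z w. w \<in> reduced_words n \<and>
             (\<forall>a\<in>carrier R. h a = word_acts R y (self_acts R a z) w))) \<and>
        (n \<ge> 2 \<longrightarrow>
          (categorical_inner R h \<longleftrightarrow>
            (\<exists>!zw. case zw of (z, w) \<Rightarrow> w \<in> reduced_words n \<and>
               (\<forall>a\<in>carrier R. h a = word_acts R y (self_acts R a z) w)))))
     \<and>
     (\<forall>h \<in> rack_aut R. categorical_inner R h \<longleftrightarrow> algebraic_inner R h)"
proof -
  \<comment> \<open>Pairs of a generator and a word are countable, so an infinite universe contains
    an injective copy of them, and all the word racks live inside it.\<close>
  obtain c :: "nat \<Rightarrow> 'u" where "inj c"
    using assms(1) infinite_countable_subset by blast
  then have e: "inj (c \<circ> to_nat :: nat \<times> nat word \<Rightarrow> 'u)"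
    by (intro inj_compose inj_to_nat)
  have "\<pi> \<in> isotropy R \<longleftrightarrow> (\<exists>!zw. case zw of (z, w) \<Rightarrow> word_form R n y \<pi> z w)"
    if "endo_family R \<pi>" for \<pi>
  proof -
    have "\<exists>z w. word_form R n y \<pi> z w" if "\<pi> \<in> isotropy R"
      by (rule isotropy_word_form[OF e assms(2) that]) blast
    then show ?thesis
      using word_form_unique[OF e assms(2)] word_form_isotropy[OF assms(2) that] by auto
  qed
  moreover have "categorical_inner R h \<longleftrightarrow>
      (\<exists>!zw. case zw of (z, w) \<Rightarrow> w \<in> reduced_words n \<and>
        (\<forall>a\<in>carrier R. h a = word_acts R y (self_acts R a z) w))"
    if "h \<in> rack_hom R R" "n \<ge> 2" for h
  proof -
    have "z = z' \<and> w = w'"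
      if "w \<in> reduced_words n" "\<forall>a\<in>carrier R. h a = word_acts R y (self_acts R a z) w"
        "w' \<in> reduced_words n" "\<forall>a\<in>carrier R. h a = word_acts R y (self_acts R a z') w'" for z w z' w'
      using that word_value_unique[OF e assms(2) \<open>n \<ge> 2\<close>, of w w' z z'] by simp
    then show ?thesis
      unfolding categorical_inner_iff[OF e assms(2) that(1)] by blast
  qed
  ultimately show ?thesis
    using categorical_inner_iff[OF e assms(2)] algebraic_inner_iff[OF e assms(2)]
    unfolding word_form_def by (simp add: rack_aut_def)
qed

end
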